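(* Let $\nu>0$ and let $\{X_n\}_{n\ge 1}$ be a sequence, bounded in $L^2(E,\mu)$, of chaos eigenfunctions of order $p$ with respect to the operator $-\mathbf{L}$ such that $\lambda_{2p}\le 2\lambda_p$, and set $Y_n=X_n+\nu$. Then the following two assertions are equivalent: (i) As $n\to\infty$, the sequence $\{Y_n\}_{n\ge 1}$ converges in distribution (under $\mu$) to a Gamma distributed random variable with parameter $\nu$, i.e. with density $\frac{1}{\Gamma(\nu)}x^{\nu-1}e^{-x}\mathbf{1}_{(0,\infty)}(x)$. (ii) As $n\to\infty$, $m_4(X_n)-6\,m_3(X_n)+6(1-\nu)\,m_2(X_n)+3\nu^2\to 0$.
   Context: $(E,\mathcal{F},\mu)$ is a probability space and $-\mathbf{L}$ is a symmetric Markov generator with state space $E$ and invariant probability measure $\mu$; that is, $-\mathbf{L}$ is a self-adjoint linear operator on $L^2(E,\mu)$ with $-\mathbf{L}(1)=0$. It is assumed that $-\mathbf{L}$ has discrete spectrum $\{\lambda_k\}_{k\ge 0}$, ordered as $0=\lambda_0<\lambda_1<\lambda_2<\cdots$, so that $L^2(E,\mu)=\bigoplus_{k=0}^\infty\mathrm{Ker}(\mathbf{L}+\lambda_k\mathbf{Id})$ (orthogonal sum), where $\mathbf{Id}$ is the identity operator. The carré du champ operator is $\Gamma(X,Y)=\frac12(\mathbf{L}(XY)-X\mathbf{L}Y-Y\mathbf{L}X)$, and $\Gamma(X)=\Gamma(X,X)$ (not to be confused with the Gamma function $\Gamma(\nu)$ of a number, which appears in the density). $\mathbf{L}$ is assumed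 diffusive: for any test function $\phi\in\mathcal{C}^\infty(\mathbb{R})$ and any $X\in L^2(E,\mu)$, $\mathbf{L}\phi(X)=\phi'(X)\mathbf{L}X+\phi''(X)\Gamma(X)$; equivalently, $\Gamma$ is a derivation in the sense that $\Gamma(\phi(X),X)=\phi'(X)\Gamma(X)$. The eigenspaces are assumed hypercontractive; in particular, on each eigenspace $\mathrm{Ker}(\mathbf{L}+\lambda_k\mathbf{Id})$, a sequence bounded in $L^2(E,\mu)$ is bounded in $L^r(E,\mu)$ for every $r\ge 1$. Chaos eigenfunction: an eigenfunction $X$ of $-\mathbf{L}$ with eigenvalue $\lambda_p$ (i.e. $\mathbf{L}X=-\lambda_pX$) is called a chaos eigenfunction of order $p$ if and only if $X^2\in\bigoplus_{k=0}^{2p}\mathrm{Ker}(\mathbf{L}+\lambda_k\mathbf{Id})$. Moments: $m_k(X)=\int_E X^k\,d\mu$.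
   Formalization: The order p is taken to be at least 1: for p = 0 the chaos eigenfunctions are constants and the equivalence fails, e.g. ν = 1 and X_n = c with c^4 − 6c^3 + 3 = 0 satisfies (ii) but not (i). *)

theory Defs
  imports "HOL-Probability.Probability"
begin

section \<open>Real $L^2$ space of square-integrable functions (not quotiented by a.e. equality)\<close>

definition L2 :: "'a measure \<Rightarrow> ('a \<Rightarrow> real) set" where
  "L2 M = {f \<in> borel_measurable M. integrable M (\<lambda>x. (f x)\<^sup>2)}"

definition L2_inner :: "'a measure \<Rightarrow> ('a \<Rightarrow> real) \<Rightarrow> ('a \<Rightarrow> real) \<Rightarrow> real" where
  "L2_inner M f g = (\<integral>x. f x * g x \<partial>M)"

definition L2_norm :: "'a measure \<Rightarrow> ('a \<Rightarrow> real) \<Rightarrow> real" where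
  "L2_norm M f = sqrt (\<integral>x. (f x)\<^sup>2 \<partial>M)"

definition bounded_in_Lr :: "'a measure \<Rightarrow> real \<Rightarrow> (nat \<Rightarrow> 'a \<Rightarrow> real) \<Rightarrow> bool" where
  "bounded_in_Lr M r Z \<longleftrightarrow>
     (\<forall>n. Z n \<in> borel_measurable M) \<and>
     (\<exists>C. \<forall>n. integrable M (\<lambda>x. \<bar>Z n x\<bar> powr r) \<and> (\<integral>x. \<bar>Z n x\<bar> powr r \<partial>M) \<le> C)"

definition moment :: "'a measure \<Rightarrow> nat \<Rightarrow> ('a \<Rightarrow> real) \<Rightarrow> real" where
  "moment M k X = (\<integral>x. X x ^ k \<partial>M)"


section \<open>Unbounded operators on $L^2$\<close>

text \<open>An operator is given by its domain \<open>D\<close> and a function \<open>A\<close> on representatives; values of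
  \<open>A\<close> outside \<open>D\<close> are irrelevant and all identities are meant almost everywhere.

  The last clause of self-adjointness says that the graph of \<open>A\<close> is the graph of the adjoint of
  \<open>A\<close>: read from left to right it is symmetry, from right to left it says that the domain of the
  adjoint is no larger than \<open>D\<close>. It also makes \<open>D\<close> and \<open>A\<close> respect a.e. equality.\<close>

definition self_adjoint ::
    "'a measure \<Rightarrow> ('a \<Rightarrow> real) set \<Rightarrow> (('a \<Rightarrow> real) \<Rightarrow> 'a \<Rightarrow> real) \<Rightarrow> bool" where
  "self_adjoint M D A \<longleftrightarrow>
     D \<subseteq> L2 M \<and> (\<forall>f\<in>D. A f \<in> L2 M) \<and>
     (\<forall>f\<in>D. \<forall>g\<in>D. \<forall>a b. (\<lambda>x. a * f x + b * g x) \<in> D \<and>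
        (AE x in M. A (\<lambda>x. a * f x + b * g x) x = a * A f x + b * A g x)) \<and>
     (\<forall>f\<in>L2 M. \<forall>e>0. \<exists>g\<in>D. L2_norm M (\<lambda>x. f x - g x) < e) \<and>
     (\<forall>f\<in>L2 M. \<forall>h\<in>L2 M.
        (f \<in> D \<and> (AE x in M. A f x = h x)) \<longleftrightarrow>
        (\<forall>g\<in>D. L2_inner M f (A g) = L2_inner M h g))"

text \<open>\<open>c\<close> is a spectral value unless \<open>A - c\<close> maps \<open>D\<close> onto $L^2$ with bounded inverse. Real \<open>c\<close>
  suffice, because only self-adjoint \<open>A\<close> are considered.\<close>

definition spectrum ::
    "'a measure \<Rightarrow> ('a \<Rightarrow> real) set \<Rightarrow> (('a \<Rightarrow> real) \<Rightarrow> 'a \<Rightarrow> real) \<Rightarrow> real set" where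
  "spectrum M D A = {c. \<not> (
     (\<forall>h\<in>L2 M. \<exists>f\<in>D. AE x in M. A f x - c * f x = h x) \<and>
     (\<exists>C. \<forall>f\<in>D. L2_norm M f \<le> C * L2_norm M (\<lambda>x. A f x - c * f x)))}"

text \<open>The kernel of \<open>L + c Id\<close>.\<close>

definition Ker_shift ::
    "'a measure \<Rightarrow> ('a \<Rightarrow> real) set \<Rightarrow> (('a \<Rightarrow> real) \<Rightarrow> 'a \<Rightarrow> real) \<Rightarrow> real \<Rightarrow> ('a \<Rightarrow> real) set" where
  "Ker_shift M D L c = {f \<in> D. AE x in M. L f x + c * f x = 0}"

definition orthogonal_family :: "'a measure \<Rightarrow> (nat \<Rightarrow> ('a \<Rightarrow> real) set) \<Rightarrow> bool" where
  "orthogonal_family M V \<longleftrightarrow>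
     (\<forall>j k. j \<noteq> k \<longrightarrow> (\<forall>f\<in>V j. \<forall>g\<in>V k. L2_inner M f g = 0))"

definition direct_sum_upto :: "'a measure \<Rightarrow> (nat \<Rightarrow> ('a \<Rightarrow> real) set) \<Rightarrow> nat \<Rightarrow> ('a \<Rightarrow> real) set" where
  "direct_sum_upto M V m =
     {f \<in> L2 M. \<exists>g. (\<forall>k\<le>m. g k \<in> V k) \<and> (AE x in M. f x = (\<Sum>k\<le>m. g k x))}"

definition hilbert_sum :: "'a measure \<Rightarrow> (nat \<Rightarrow> ('a \<Rightarrow> real) set) \<Rightarrow> ('a \<Rightarrow> real) set" where
  "hilbert_sum M V =
     {f \<in> L2 M. \<exists>g. (\<forall>k. g k \<in> V k) \<and>
        (\<lambda>n. L2_norm M (\<lambda>x. f x - (\<Sum>k<n. g k x))) \<longlonglongrightarrow> 0}"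


section \<open>Diffusive Markov generators\<close>

text \<open>Only meaningful when \<open>X\<close>, \<open>Y\<close> and \<open>X Y\<close> lie in the domain of \<open>L\<close>.\<close>

definition carre_du_champ ::
    "(('a \<Rightarrow> real) \<Rightarrow> 'a \<Rightarrow> real) \<Rightarrow> ('a \<Rightarrow> real) \<Rightarrow> ('a \<Rightarrow> real) \<Rightarrow> 'a \<Rightarrow> real" where
  "carre_du_champ L X Y = (\<lambda>x. (L (\<lambda>y. X y * Y y) x - X x * L Y x - Y x * L X x) / 2)"

definition smooth_fun :: "(real \<Rightarrow> real) \<Rightarrow> bool" where
  "smooth_fun \<phi> \<longleftrightarrow> (\<forall>k x. ((deriv ^^ k) \<phi>) differentiable (at x))"

text \<open>The chain rule \<open>L \<phi>(X) = \<phi>'(X) L X + \<phi>''(X) \<Gamma>(X)\<close>, with the domain conditions that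
  are needed because \<open>L\<close> is unbounded. The right-hand side makes sense when \<open>X\<close> and \<open>X\<^sup>2\<close> lie in
  the domain. For every smooth \<open>\<phi>\<close> the identity is required as soon as \<open>\<phi>(X)\<close> is in the domain;
  and \<open>\<phi>(X)\<close> is required to be in the domain only if \<open>\<phi>'\<close> and \<open>\<phi>''\<close> are bounded and \<open>\<Gamma>(X)\<close> is
  in $L^2$, in which case \<open>\<phi>(X)\<close> and the right-hand side are in $L^2$.\<close>

definition diffusive ::
    "'a measure \<Rightarrow> ('a \<Rightarrow> real) set \<Rightarrow> (('a \<Rightarrow> real) \<Rightarrow> 'a \<Rightarrow> real) \<Rightarrow> bool" where
  "diffusive M D L \<longleftrightarrow>
     (\<forall>\<phi> X. smooth_fun \<phi> \<and> X \<in> D \<and> (\<lambda>x. X x * X x) \<in> D \<longrightarrow>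
        ((\<lambda>x. \<phi> (X x)) \<in> D \<longrightarrow>
           (AE x in M. L (\<lambda>y. \<phi> (X y)) x =
              deriv \<phi> (X x) * L X x + deriv (deriv \<phi>) (X x) * carre_du_champ L X X x)) \<and>
        (bounded (range (deriv \<phi>)) \<and> bounded (range (deriv (deriv \<phi>))) \<and>
           carre_du_champ L X X \<in> L2 M \<longrightarrow>
           (\<lambda>x. \<phi> (X x)) \<in> D))"

locale diffusive_markov_generator = prob_space M
  for M :: "'a measure" +
  fixes D :: "('a \<Rightarrow> real) set"
    and L :: "('a \<Rightarrow> real) \<Rightarrow> 'a \<Rightarrow> real"
    and lam :: "nat \<Rightarrow> real"
  assumes self_adjoint_L: "self_adjoint M D (\<lambda>f x. - L f x)"
    and one_in_domain: "(\<lambda>_. 1) \<in> D"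
    and L_one: "AE x in M. L (\<lambda>_. 1) x = 0"
    and spectrum_L: "spectrum M D (\<lambda>f x. - L f x) = range lam"
    and lam_0: "lam 0 = 0"
    and lam_strict_mono: "strict_mono lam"
    and eigenspaces_orthogonal: "orthogonal_family M (\<lambda>k. Ker_shift M D L (lam k))"
    and L2_decomposition: "L2 M = hilbert_sum M (\<lambda>k. Ker_shift M D L (lam k))"
    and diffusive_L: "diffusive M D L"
    and hypercontractive:
      "\<And>k r Z. r \<ge> 1 \<Longrightarrow> (\<And>n. Z n \<in> Ker_shift M D L (lam k)) \<Longrightarrow>
         bounded_in_Lr M 2 Z \<Longrightarrow> bounded_in_Lr M r Z"

definition chaos_eigenfunction ::
    "'a measure \<Rightarrow> ('a \<Rightarrow> real) set \<Rightarrow> (('a \<Rightarrow> real) \<Rightarrow> 'a \<Rightarrow> real) \<Rightarrow> (nat \<Rightarrow> real) \<Rightarrow>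
     nat \<Rightarrow> ('a \<Rightarrow> real) \<Rightarrow> bool" where
  "chaos_eigenfunction M D L lam p X \<longleftrightarrow>
     X \<in> Ker_shift M D L (lam p) \<and>
     (\<lambda>x. (X x)\<^sup>2) \<in> direct_sum_upto M (\<lambda>k. Ker_shift M D L (lam k)) (2 * p)"


section \<open>Gamma distribution\<close>

definition gamma_density :: "real \<Rightarrow> real \<Rightarrow> real" where
  "gamma_density \<nu> x = 1 / Gamma \<nu> * x powr (\<nu> - 1) * exp (- x) * indicator {0<..} x"

definition gamma_distribution :: "real \<Rightarrow> real measure" where
  "gamma_distribution \<nu> = density lborel (\<lambda>x. ennreal (gamma_density \<nu> x))"

end

theory Submission
  imports Defs
begin

text \<open>
  Write \<open>\<lambda>\<close> for the eigenvalue \<open>lam p\<close> and \<open>G\<close> for \<open>\<Gamma>(X)\<close>. The Gamma law with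
  parameter \<open>\<nu>\<close> is the only law with finite second moment that satisfies the Stein identity
  \<open>E[(Y - \<nu>) f(Y)] = E[Y f'(Y)]\<close> for all exponentials \<open>f(y) = exp(isy)\<close>. On the other side, the
  diffusion property says that \<open>\<lambda> E[X f(X)] = E[f'(X) G]\<close>. Hence \<open>Y = X + \<nu>\<close> is nearly Gamma
  distributed as soon as \<open>G - \<lambda> Y\<close> is small in \<open>L\<^sup>2\<close>.

  The chaos property makes this quantity computable. Since \<open>G = (L + 2\<lambda>)(X\<^sup>2) / 2\<close>, one has
  \<open>G - \<lambda> Y = (L + 2\<lambda>) U / 2\<close> with \<open>U = X\<^sup>2 - 2X - \<nu>\<close>, and \<open>U\<close> only has components in the
  eigenspaces of index at most \<open>2p\<close>, on which \<open>L + 2\<lambda>\<close> acts by a factor between \<open>0\<close> and \<open>2\<lambda>\<close>.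
  Therefore \<open>\<parallel>(L + 2\<lambda>) U\<parallel>\<^sup>2 \<le> 2\<lambda> \<langle>U, (L + 2\<lambda>) U\<rangle>\<close> (\<open>spectral_inequality\<close>), and the right-hand
  side involves only \<open>E[X\<^sup>k]\<close> and \<open>E[X\<^sup>k G]\<close>, where \<open>E[X\<^sup>k G] = \<lambda> E[X\<^sup>k\<^sup>+\<^sup>2] / (k + 1)\<close>. It turns
  out to be a multiple of the moment expression in assertion (ii) (\<open>carre_deviation_bound\<close>).

  For (ii) implies (i), the approximate Stein identity is an approximate first-order linear
  differential equation for the characteristic function of \<open>Y\<close>. Solving it with the integrating
  factor \<open>(1 - it) powr \<nu>\<close> gives an explicit bound for the distance to the characteristic function
  of the Gamma law (\<open>approximate_Stein_identity_imp_char_close\<close>), and Levy's continuity theorem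
  applies.

  For (i) implies (ii), hypercontractivity bounds all moments of the sequence, so the second,
  third and fourth centred moments converge to those of the Gamma law
  (\<open>weak_conv_imp_expectation_conv\<close>), for which the expression in (ii) vanishes.
\<close>

section \<open>Characteristic functions and Stein's identity\<close>

lemma (in prob_space) has_vector_derivative_expectation_iexp:
  fixes Y :: "'a \<Rightarrow> real"
  assumes [measurable]: "Y \<in> borel_measurable M" and sq: "integrable M (\<lambda>x. (Y x)\<^sup>2)"
  shows "((\<lambda>t. CLINT x|M. iexp (t * Y x)) has_vector_derivative
           \<i> * (CLINT x|M. Y x * iexp (t * Y x))) (at t)"
proof -
  have Y: "integrable M Y"
    by (rule square_integrable_imp_integrable) (use sq in auto)
  have int1: "integrable M (\<lambda>x. iexp (s * Y x))" for s
    by (rule integrable_iexp) auto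
  have int2: "integrable M (\<lambda>x. complex_of_real (Y x) * iexp (s * Y x))" for s
    by (rule Bochner_Integration.integrable_bound[OF Y]) (auto simp: norm_mult)
  define f where "f = (\<lambda>t. CLINT x|M. iexp (t * Y x))"
  define A where "A = \<i> * (CLINT x|M. Y x * iexp (t * Y x))"
  define C where "C = (\<integral>x. (Y x)\<^sup>2 \<partial>M) / 2"
  have bound: "norm (f (t + h) - f t - h *\<^sub>R A) \<le> h\<^sup>2 * C" for h
  proof -
    \<comment> \<open>First-order Taylor expansion of the exponential with its quadratic remainder.\<close>
    have pw: "norm (iexp (y * (t + h)) - iexp (t * y) - h *\<^sub>R (\<i> * (y * iexp (t * y)))) \<le> h\<^sup>2 / 2 * y\<^sup>2"
      for y :: real
    proof -
      have "iexp (y * (t + h)) - iexp (t * y) - h *\<^sub>R (\<i> * (y * iexp (t * y))) =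
            iexp (t * y) * (iexp (h * y) - (\<Sum>k\<le>1. (\<i> * (h * y))^k / fact k))"
        by (simp add: ring_distribs exp_add scaleR_conv_of_real) (simp add: mult_ac)
      then have "norm (iexp (y * (t + h)) - iexp (t * y) - h *\<^sub>R (\<i> * (y * iexp (t * y)))) =
          norm (iexp (h * y) - (\<Sum>k\<le>1. (\<i> * (h * y))^k / fact k))"
        by (simp add: norm_mult)
      also have "\<dots> \<le> \<bar>h * y\<bar> ^ Suc 1 / fact (Suc 1)"
        using iexp_approx1[of "h * y" 1] by simp
      finally show ?thesis by (simp add: power_mult_distrib flip: power2_eq_square)
    qed
    have "f (t + h) - f t - h *\<^sub>R A =
       (CLINT x|M. iexp (Y x * (t + h)) - iexp (t * Y x) - h *\<^sub>R (\<i> * (Y x * iexp (t * Y x))))"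
      using int1[of "t + h"] int1[of t] int2[of t] unfolding f_def A_def
      by (simp add: mult.commute)
    also have "norm \<dots> \<le> (\<integral>x. h\<^sup>2 / 2 * (Y x)\<^sup>2 \<partial>M)"
    proof (rule order_trans[OF integral_norm_bound integral_mono], rule integrable_norm)
      show "integrable M (\<lambda>x. iexp (Y x * (t + h)) - iexp (t * Y x) - h *\<^sub>R (\<i> * (Y x * iexp (t * Y x))))"
        using int1[of "t + h"] int1[of t] int2[of t] by (simp add: mult.commute)
    qed (use sq pw in auto)
    also have "\<dots> = h\<^sup>2 * C" by (simp add: C_def)
    finally show ?thesis .
  qed
  have "((\<lambda>h. norm (f (t + h) - f t - h *\<^sub>R A) / norm h) \<longlongrightarrow> 0) (at 0)"
  proof (rule Lim_null_comparison)
    show "\<forall>\<^sub>F h in at 0. norm (norm (f (t + h) - f t - h *\<^sub>R A) / norm h) \<le> \<bar>h\<bar> * C"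
    proof (rule always_eventually, rule allI)
      fix h :: real
      show "norm (norm (f (t + h) - f t - h *\<^sub>R A) / norm h) \<le> \<bar>h\<bar> * C"
      proof (cases "h = 0")
        case False
        have "norm (f (t + h) - f t - h *\<^sub>R A) / norm h \<le> (h\<^sup>2 * C) / norm h"
          by (rule divide_right_mono[OF bound]) simp
        also have "\<dots> = \<bar>h\<bar> * C" using False by (simp add: power2_eq_square field_simps abs_if)
        finally show ?thesis by simp
      qed simp
    qed
    have "((\<lambda>h. \<bar>h\<bar> * C) \<longlongrightarrow> \<bar>0::real\<bar> * C) (at 0)" by (intro tendsto_intros)
    then show "((\<lambda>h. \<bar>h\<bar> * C) \<longlongrightarrow> 0) (at 0)" by simp
  qed
  then show ?thesis
    unfolding has_vector_derivative_def has_derivative_at f_def[symmetric] A_def[symmetric]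
    by (simp add: bounded_linear_scaleR_left)
qed

text \<open>
  With \<open>\<phi>\<close> the characteristic function of \<open>Y\<close> and \<open>\<phi>'(t) = i E[Y exp(itY)]\<close>, the hypothesis says
  that \<open>(1 - it) E[Y exp(itY)] = \<nu> \<phi>(t)\<close> up to an error of size \<open>\<delta> \<bar>t\<bar>\<close>. The equation without
  error is solved by multiples of \<open>(1 - it) powr (- \<nu>)\<close>, so \<open>\<phi>(t) (1 - it) powr \<nu>\<close> has a
  derivative of the size of the error and stays close to its value \<open>1\<close> at \<open>0\<close>.
\<close>
lemma (in prob_space) approximate_Stein_identity_imp_char_close:
  fixes Y :: "'a \<Rightarrow> real"
  assumes Ym[measurable]: "Y \<in> borel_measurable M" and sq: "integrable M (\<lambda>x. (Y x)\<^sup>2)"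
    and nu: "\<nu> > 0"
    and stein: "\<And>s. norm ((CLINT x|M. (Y x - \<nu>) * iexp (s * Y x)) -
                  \<i> * s * (CLINT x|M. Y x * iexp (s * Y x))) \<le> \<delta> * \<bar>s\<bar>"
  shows "norm ((CLINT x|M. iexp (t * Y x)) * (1 - \<i> * t) powr \<nu> - 1)
           \<le> \<delta> * t\<^sup>2 * (1 + \<bar>t\<bar>) powr \<nu>"
proof -
  have Y: "integrable M Y"
    by (rule square_integrable_imp_integrable) (use sq in auto)
  have int1: "integrable M (\<lambda>x. iexp (s * Y x))" for s
    by (rule integrable_iexp) auto
  have int2: "integrable M (\<lambda>x. complex_of_real (Y x) * iexp (s * Y x))" for s
    by (rule Bochner_Integration.integrable_bound[OF Y]) (auto simp: norm_mult)
  define f where "f = (\<lambda>t. CLINT x|M. iexp (t * Y x))"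
  define A where "A = (\<lambda>t::real. CLINT x|M. Y x * iexp (t * Y x))"
  define \<epsilon> where "\<epsilon> = (\<lambda>s::real. (1 - \<i> * s) * A s - \<nu> * f s)"
  have delta: "\<delta> \<ge> 0"
    using order_trans[OF norm_ge_zero stein[of 1]] by simp
  have eps: "norm (\<epsilon> s) \<le> \<delta> * \<bar>s\<bar>" for s
  proof -
    have "(CLINT x|M. (Y x - \<nu>) * iexp (s * Y x)) = A s - \<nu> * f s"
      using int1[of s] int2[of s] unfolding A_def f_def by (simp add: left_diff_distrib)
    then have "norm ((A s - \<nu> * f s) - \<i> * s * A s) \<le> \<delta> * \<bar>s\<bar>"
      using stein[of s] by (simp only: A_def)
    moreover have "\<epsilon> s = (A s - \<nu> * f s) - \<i> * s * A s"
      unfolding \<epsilon>_def by (simp add: left_diff_distrib)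
    ultimately show ?thesis by simp
  qed
  have nz: "1 - \<i> * complex_of_real s \<noteq> 0" for s
    by (auto simp: complex_eq_iff)
  have nonpos: "1 - \<i> * complex_of_real s \<notin> \<real>\<^sub>\<le>\<^sub>0" for s
    by (auto simp: complex_nonpos_Reals_iff)
  have norm1: "norm (1 - \<i> * complex_of_real s) \<ge> 1" for s
    using complex_Re_le_cmod[of "1 - \<i> * complex_of_real s"] by simp
  define h where "h = (\<lambda>s::real. (1 - \<i> * s) powr complex_of_real \<nu>)"
  have h': "(h has_vector_derivative - \<i> * \<nu> / (1 - \<i> * s) * h s) (at s)" for s
  proof -
    have "((\<lambda>z. (1 - \<i> * z) powr complex_of_real \<nu>) has_field_derivative
             - \<i> * \<nu> / (1 - \<i> * s) * h s) (at (complex_of_real s))"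
      using nonpos[of s] nz[of s]
      by (auto intro!: derivative_eq_intros simp: h_def powr_diff field_simps)
    then show ?thesis
      unfolding h_def by (rule has_vector_derivative_real_field)
  qed
  have f': "(f has_vector_derivative \<i> * A s) (at s)" for s
    unfolding f_def A_def by (rule has_vector_derivative_expectation_iexp[OF Ym sq])
  define g where "g = (\<lambda>s. f s * h s)"
  \<comment> \<open>The integrating factor leaves only the error term in the derivative.\<close>
  have g': "(g has_vector_derivative \<i> * \<epsilon> s / (1 - \<i> * s) * h s) (at s)" for s
  proof -
    have "(g has_vector_derivative f s * (- \<i> * \<nu> / (1 - \<i> * s) * h s) + \<i> * A s * h s) (at s)"
      unfolding g_def by (rule has_vector_derivative_mult[OF f' h'])
    also have "f s * (- \<i> * \<nu> / (1 - \<i> * s) * h s) + \<i> * A s * h s = \<i> * \<epsilon> s / (1 - \<i> * s) * h s"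
      using nz[of s] unfolding \<epsilon>_def by (simp add: divide_simps) (simp add: algebra_simps)
    finally show ?thesis .
  qed
  define T where "T = \<bar>t\<bar>"
  have bound: "norm (\<i> * \<epsilon> s / (1 - \<i> * s) * h s) \<le> \<delta> * T * (1 + T) powr \<nu>" if "s \<in> {-T..T}" for s
  proof -
    have s: "\<bar>s\<bar> \<le> T" using that by auto
    have "norm (h s) = norm (1 - \<i> * complex_of_real s) powr \<nu>"
      by (simp add: h_def norm_powr_real_powr')
    also have "\<dots> \<le> (1 + T) powr \<nu>"
    proof (rule powr_mono2)
      have "norm (1 - \<i> * complex_of_real s) \<le> norm (1::complex) + norm (\<i> * complex_of_real s)"
        by (rule norm_triangle_ineq4)
      then show "norm (1 - \<i> * complex_of_real s) \<le> 1 + T" using s by (simp add: norm_mult)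
    qed (use nu in auto)
    finally have 1: "norm (h s) \<le> (1 + T) powr \<nu>" .
    have "norm (\<epsilon> s) / norm (1 - \<i> * complex_of_real s) \<le> norm (\<epsilon> s)"
      using norm1[of s] by (simp add: divide_le_eq mult_le_cancel_left1)
    also have "\<dots> \<le> \<delta> * T"
      using eps[of s] s delta by (meson mult_left_mono order_trans)
    finally have "norm (\<epsilon> s) / norm (1 - \<i> * complex_of_real s) * norm (h s) \<le> \<delta> * T * (1 + T) powr \<nu>"
      using 1 delta s by (intro mult_mono) auto
    then show ?thesis by (simp add: norm_mult norm_divide)
  qed
  have "norm (g t - g 0) \<le> \<delta> * T * (1 + T) powr \<nu> * norm (t - 0)"
  proof (rule differentiable_bound)
    show "convex {-T..T}" by simp
    fix s assume s: "s \<in> {-T..T}"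
    show "(g has_derivative (\<lambda>r. r *\<^sub>R (\<i> * \<epsilon> s / (1 - \<i> * s) * h s))) (at s within {-T..T})"
      using g'[of s] unfolding has_vector_derivative_def by (rule has_derivative_at_withinI)
    show "onorm (\<lambda>r. r *\<^sub>R (\<i> * \<epsilon> s / (1 - \<i> * s) * h s)) \<le> \<delta> * T * (1 + T) powr \<nu>"
    proof (rule onorm_bound)
      show "0 \<le> \<delta> * T * (1 + T) powr \<nu>" using bound[OF s] norm_ge_zero order_trans by blast
      fix r :: real
      have "norm (r *\<^sub>R (\<i> * \<epsilon> s / (1 - \<i> * s) * h s)) = \<bar>r\<bar> * norm (\<i> * \<epsilon> s / (1 - \<i> * s) * h s)"
        by (rule norm_scaleR)
      also have "\<dots> \<le> \<bar>r\<bar> * (\<delta> * T * (1 + T) powr \<nu>)"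
        by (rule mult_left_mono[OF bound[OF s]]) simp
      finally show "norm (r *\<^sub>R (\<i> * \<epsilon> s / (1 - \<i> * s) * h s)) \<le> \<delta> * T * (1 + T) powr \<nu> * norm r"
        by (simp only: real_norm_def mult.commute)
    qed
  qed (auto simp: T_def)
  also have "\<delta> * T * (1 + T) powr \<nu> * norm (t - 0) = \<delta> * t\<^sup>2 * (1 + T) powr \<nu>"
    by (simp add: T_def power2_eq_square abs_if)
  also have "g 0 = 1" by (simp add: g_def f_def h_def prob_space)
  finally show ?thesis by (simp add: g_def f_def h_def T_def)
qed

section \<open>Convergence of moments under weak convergence\<close>

text \<open>
  A uniform bound on \<open>E[f\<^sup>2]\<close> replaces the boundedness of \<open>f\<close>: the truncation of \<open>f\<close> at height \<open>R\<close>
  is bounded and continuous, and differs from \<open>f\<close> by at most \<open>f\<^sup>2 / R\<close> pointwise.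
\<close>
lemma weak_conv_imp_expectation_conv:
  fixes f :: "real \<Rightarrow> real"
  assumes real: "\<And>n. real_distribution (\<mu> n)" "real_distribution \<mu>'"
    and conv: "weak_conv_m \<mu> \<mu>'"
    and cont: "continuous_on UNIV f"
    and int: "\<And>n. integrable (\<mu> n) (\<lambda>x. (f x)\<^sup>2)" "integrable \<mu>' (\<lambda>x. (f x)\<^sup>2)"
    and bound: "\<And>n. (\<integral>x. (f x)\<^sup>2 \<partial>\<mu> n) \<le> C"
  shows "(\<lambda>n. \<integral>x. f x \<partial>\<mu> n) \<longlonglongrightarrow> (\<integral>x. f x \<partial>\<mu>')"
proof -
  interpret M: real_distribution "\<mu> n" for n by (rule real)
  interpret M': real_distribution \<mu>' by (rule real)
  have meas[measurable]: "f \<in> borel_measurable borel"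
    using cont by (rule borel_measurable_continuous_onI)
  define trunc where "trunc = (\<lambda>R x. max (- R) (min R (f x)))"
  have trunc_meas[measurable]: "trunc R \<in> borel_measurable borel" for R
    unfolding trunc_def by measurable
  have trunc_close: "\<bar>f x - trunc R x\<bar> \<le> (f x)\<^sup>2 / R" if "R > 0" for R x
  proof (cases "\<bar>f x\<bar> \<le> R")
    case False
    then have "\<bar>f x - trunc R x\<bar> \<le> \<bar>f x\<bar>" using that by (auto simp: trunc_def)
    also have "\<dots> \<le> (f x)\<^sup>2 / R"
    proof -
      have "\<bar>f x\<bar> * R \<le> \<bar>f x\<bar> * \<bar>f x\<bar>" using False by (intro mult_left_mono) auto
      then show ?thesis using that by (simp add: pos_le_divide_eq power2_eq_square)
    qed
    finally show ?thesis .
  qed (use that in \<open>auto simp: trunc_def\<close>)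
  have close: "\<bar>(\<integral>x. f x \<partial>N) - (\<integral>x. trunc R x \<partial>N)\<bar> \<le> (\<integral>x. (f x)\<^sup>2 \<partial>N) / R"
    if N: "real_distribution N" and sq: "integrable N (\<lambda>x. (f x)\<^sup>2)" and R: "R > 0" for N R
  proof -
    interpret real_distribution N by (rule N)
    have [measurable]: "f \<in> borel_measurable N" "trunc R \<in> borel_measurable N" by simp_all
    have f: "integrable N f"
      by (rule square_integrable_imp_integrable) (use sq in auto)
    have t: "integrable N (trunc R)"
      by (rule integrable_const_bound[where B = R]) (use R in \<open>auto simp: trunc_def\<close>)
    have "\<bar>(\<integral>x. f x \<partial>N) - (\<integral>x. trunc R x \<partial>N)\<bar> = norm (\<integral>x. f x - trunc R x \<partial>N)"
      using f t by simp
    also have "\<dots> \<le> (\<integral>x. (f x)\<^sup>2 / R \<partial>N)"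
      by (rule Bochner_Integration.integral_norm_bound_integral) (use f t sq trunc_close[OF R] in auto)
    finally show ?thesis by simp
  qed
  show ?thesis
  proof (rule LIMSEQ_I)
    fix r :: real assume r: "r > 0"
    define C' where "C' = max 1 (max C (\<integral>x. (f x)\<^sup>2 \<partial>\<mu>'))"
    \<comment> \<open>With this truncation height, each of the two truncation errors is at most \<open>r / 4\<close>.\<close>
    define R where "R = 4 * C' / r"
    have "C' > 0" by (simp add: C'_def)
    then have R: "R > 0" using r by (simp add: R_def)
    have C'R: "C' / R = r / 4" using r \<open>C' > 0\<close> by (simp add: R_def)
    have "(\<lambda>n. \<integral>x. trunc R x \<partial>\<mu> n) \<longlonglongrightarrow> (\<integral>x. trunc R x \<partial>\<mu>')"
    proof (rule weak_conv_imp_integral_bdd_continuous_conv[OF real conv])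
      fix x
      have "isCont f x" using cont by (simp add: continuous_on_eq_continuous_at)
      then show "isCont (trunc R) x" unfolding trunc_def by (intro continuous_intros)
      show "norm (trunc R x) \<le> R" using R by (auto simp: trunc_def)
    qed
    then obtain n0 where n0: "\<And>n. n \<ge> n0 \<Longrightarrow>
        norm ((\<integral>x. trunc R x \<partial>\<mu> n) - (\<integral>x. trunc R x \<partial>\<mu>')) < r / 4"
      using r by (meson LIMSEQ_D divide_pos_pos zero_less_numeral)
    have "norm ((\<integral>x. f x \<partial>\<mu> n) - (\<integral>x. f x \<partial>\<mu>')) < r" if "n \<ge> n0" for n
    proof -
      have "\<bar>(\<integral>x. f x \<partial>\<mu> n) - (\<integral>x. trunc R x \<partial>\<mu> n)\<bar> \<le> (\<integral>x. (f x)\<^sup>2 \<partial>\<mu> n) / R"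
        by (rule close[OF real(1) int(1) R])
      also have "\<dots> \<le> C' / R"
        by (rule divide_right_mono) (use bound[of n] R in \<open>auto simp: C'_def\<close>)
      finally have 1: "\<bar>(\<integral>x. f x \<partial>\<mu> n) - (\<integral>x. trunc R x \<partial>\<mu> n)\<bar> \<le> r / 4" using C'R by simp
      have "\<bar>(\<integral>x. f x \<partial>\<mu>') - (\<integral>x. trunc R x \<partial>\<mu>')\<bar> \<le> (\<integral>x. (f x)\<^sup>2 \<partial>\<mu>') / R"
        by (rule close[OF real(2) int(2) R])
      also have "\<dots> \<le> C' / R"
        by (rule divide_right_mono) (use R in \<open>auto simp: C'_def\<close>)
      finally have 2: "\<bar>(\<integral>x. f x \<partial>\<mu>') - (\<integral>x. trunc R x \<partial>\<mu>')\<bar> \<le> r / 4" using C'R by simp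
      show ?thesis using 1 2 n0[OF that] r by (simp add: abs_if split: if_splits)
    qed
    then show "\<exists>n0. \<forall>n\<ge>n0. norm ((\<integral>x. f x \<partial>\<mu> n) - (\<integral>x. f x \<partial>\<mu>')) < r" by blast
  qed
qed

section \<open>The Gamma distribution\<close>

lemma has_bochner_integral_Gamma:
  assumes a: "a > (0::real)"
  shows "has_bochner_integral lborel (\<lambda>x. indicator {0<..} x * (x powr (a - 1) * exp (- x))) (Gamma a)"
proof (rule has_bochner_integral_nn_integral)
  have "(\<integral>\<^sup>+x. ennreal (indicator {0<..} x * (x powr (a - 1) * exp (- x))) \<partial>lborel) =
        (\<integral>\<^sup>+x. ennreal (indicator {0..} x * x powr (a - 1) / exp x) \<partial>lborel)"
    by (intro nn_integral_cong) (auto simp: indicator_def exp_minus field_simps)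
  then show "(\<integral>\<^sup>+x. ennreal (indicator {0<..} x * (x powr (a - 1) * exp (- x))) \<partial>lborel) = ennreal (Gamma a)"
    using Gamma_conv_nn_integral_real[OF a] by simp
qed (use a in \<open>auto simp: Gamma_real_pos less_imp_le\<close>)

lemma borel_measurable_gamma_density [measurable]: "gamma_density \<nu> \<in> borel_measurable borel"
  unfolding gamma_density_def[abs_def] by measurable

lemma gamma_density_nonneg: "\<nu> > 0 \<Longrightarrow> 0 \<le> gamma_density \<nu> x"
  by (simp add: gamma_density_def Gamma_real_pos less_imp_le)

lemma gamma_distribution_moment:
  assumes nu: "\<nu> > 0"
  shows "has_bochner_integral (gamma_distribution \<nu>) (\<lambda>x. x ^ k) (pochhammer \<nu> k)"
proof -
  have "has_bochner_integral lborel
          (\<lambda>x. indicator {0<..} x * (x powr (\<nu> + k - 1) * exp (- x)) / Gamma \<nu>) (Gamma (\<nu> + k) / Gamma \<nu>)"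
    by (intro has_bochner_integral_divide_zero has_bochner_integral_Gamma) (use nu in auto)
  also have "(\<lambda>x. indicator {0<..} x * (x powr (\<nu> + k - 1) * exp (- x)) / Gamma \<nu>) =
             (\<lambda>x. gamma_density \<nu> x *\<^sub>R x ^ k)"
    by (auto simp: gamma_density_def fun_eq_iff indicator_def powr_add powr_diff powr_realpow mult_ac)
  also have "Gamma (\<nu> + k) / Gamma \<nu> = pochhammer \<nu> k"
    using nu by (subst pochhammer_Gamma) (auto elim!: nonpos_Ints_cases)
  finally show ?thesis
    unfolding gamma_distribution_def
    by (intro has_bochner_integral_density) (auto simp: gamma_density_nonneg nu)
qed

lemma real_distribution_gamma:
  assumes nu: "\<nu> > 0"
  shows "real_distribution (gamma_distribution \<nu>)"
proof -
  have "(\<integral>\<^sup>+x. ennreal (gamma_density \<nu> x) \<partial>lborel) = 1"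
  proof -
    have "has_bochner_integral lborel (\<lambda>x. gamma_density \<nu> x) 1"
    proof -
      have "has_bochner_integral lborel
          (\<lambda>x. indicator {0<..} x * (x powr (\<nu> - 1) * exp (- x)) / Gamma \<nu>) (Gamma \<nu> / Gamma \<nu>)"
        by (intro has_bochner_integral_divide_zero has_bochner_integral_Gamma) (use nu in auto)
      moreover have "Gamma \<nu> > 0" using nu by (rule Gamma_real_pos)
      ultimately show ?thesis by (simp add: gamma_density_def mult_ac)
    qed
    then show ?thesis
      by (subst nn_integral_eq_integral)
         (auto simp: has_bochner_integral_iff gamma_density_nonneg nu)
  qed
  then have "prob_space (gamma_distribution \<nu>)"
    unfolding gamma_distribution_def by (intro prob_spaceI) (simp add: emeasure_density)
  then show ?thesis
    by (simp add: real_distribution_def real_distribution_axioms_def gamma_distribution_def)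
qed

lemma integrable_gamma_poly:
  assumes nu: "\<nu> > 0"
  shows "integrable (gamma_distribution \<nu>) (poly p)"
  unfolding poly_altdef
  using gamma_distribution_moment[OF nu] by (intro Bochner_Integration.integrable_sum integrable_mult_right)
    (auto simp: has_bochner_integral_iff)

text \<open>
  The difference of the two sides is, up to sign and normalisation, the integral over \<open>(0, \<infinity>)\<close> of
  the derivative of \<open>y powr \<nu> * exp (- y) * exp (isy)\<close>, which vanishes at both ends.
\<close>
lemma gamma_Stein_identity:
  assumes nu: "\<nu> > 0"
  shows "(CLINT x|gamma_distribution \<nu>. (x - \<nu>) * iexp (s * x)) =
         \<i> * s * (CLINT x|gamma_distribution \<nu>. x * iexp (s * x))"
proof -
  interpret G: real_distribution "gamma_distribution \<nu>" using nu by (rule real_distribution_gamma)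
  have int0: "integrable (gamma_distribution \<nu>) (\<lambda>x::real. x)"
    using gamma_distribution_moment[OF nu, of 1] by (simp add: has_bochner_integral_iff)
  have int1: "integrable (gamma_distribution \<nu>) (\<lambda>x. iexp (s * x))"
    by (rule G.integrable_iexp) auto
  have int2: "integrable (gamma_distribution \<nu>) (\<lambda>x. complex_of_real x * iexp (s * x))"
    by (rule Bochner_Integration.integrable_bound[OF int0]) (auto simp: norm_mult)
  define F where "F = (\<lambda>y::real. (y powr \<nu> * exp (- y)) *\<^sub>R iexp (s * y))"
  define f where "f = (\<lambda>y::real. (y powr (\<nu> - 1) * exp (- y)) *\<^sub>R ((\<nu> - y + \<i> * s * y) * iexp (s * y)))"
  have F': "(F has_vector_derivative f y) (at y)" if "y > 0" for y
  proof -
    have 1: "((\<lambda>y. y powr \<nu> * exp (- y)) has_real_derivative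
            y powr (\<nu> - 1) * exp (- y) * (\<nu> - y)) (at y)"
      using that by (auto intro!: derivative_eq_intros simp: powr_diff field_simps)
    have 2: "((\<lambda>y. iexp (s * y)) has_vector_derivative (\<i> * s * iexp (s * y))) (at y)"
    proof -
      have "((\<lambda>z. exp (\<i> * (s * z))) has_field_derivative \<i> * s * iexp (s * y)) (at (complex_of_real y))"
        by (auto intro!: derivative_eq_intros)
      from has_vector_derivative_real_field[OF this] show ?thesis by simp
    qed
    have p: "y powr \<nu> = y powr (\<nu> - 1) * y" using that by (simp add: powr_diff)
    have "(F has_vector_derivative
        (y powr \<nu> * exp (- y)) *\<^sub>R (\<i> * s * iexp (s * y)) +
        (y powr (\<nu> - 1) * exp (- y) * (\<nu> - y)) *\<^sub>R iexp (s * y)) (at y)"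
      unfolding F_def by (rule has_vector_derivative_scaleR[OF 1 2])
    also have "(y powr \<nu> * exp (- y)) *\<^sub>R (\<i> * s * iexp (s * y)) +
        (y powr (\<nu> - 1) * exp (- y) * (\<nu> - y)) *\<^sub>R iexp (s * y) = f y"
      unfolding f_def p by (simp add: scaleR_conv_of_real algebra_simps)
    finally show ?thesis .
  qed
  have density: "gamma_density \<nu> y *\<^sub>R ((\<nu> - y + \<i> * s * y) * iexp (s * y)) =
                 (1 / Gamma \<nu>) *\<^sub>R (indicator {0<..} y *\<^sub>R f y)" for y
    by (auto simp: gamma_density_def f_def scaleR_conv_of_real indicator_def)
  have integrand: "(\<lambda>x. (\<nu> - x + \<i> * s * x) * iexp (s * x)) =
      (\<lambda>x. \<nu> * iexp (s * x) - x * iexp (s * x) + \<i> * s * (x * iexp (s * x)))"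
    by (auto simp: algebra_simps)
  have int3: "integrable (gamma_distribution \<nu>) (\<lambda>x. (\<nu> - x + \<i> * s * x) * iexp (s * x))"
    unfolding integrand using int1 int2
    by (intro Bochner_Integration.integrable_add Bochner_Integration.integrable_diff integrable_mult_right)
  have Gpos: "Gamma \<nu> > 0" using nu by (rule Gamma_real_pos)
  have "integrable lborel
      (\<lambda>y. gamma_density \<nu> y *\<^sub>R ((\<nu> - y + \<i> * s * y) * iexp (s * y)))"
    using int3 unfolding gamma_distribution_def
    by (subst (asm) integrable_density) (auto simp: gamma_density_nonneg nu)
  then have fi: "integrable lborel (\<lambda>y. (1 / Gamma \<nu>) *\<^sub>R (indicator {0<..} y *\<^sub>R f y))"
    unfolding density .
  have "integrable lborel (\<lambda>y. Gamma \<nu> *\<^sub>R (1 / Gamma \<nu>) *\<^sub>R (indicator {0<..} y *\<^sub>R f y))"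
    by (rule integrable_scaleR_right) (rule fi)
  moreover have "(\<lambda>y. Gamma \<nu> *\<^sub>R (1 / Gamma \<nu>) *\<^sub>R (indicator {0<..} y *\<^sub>R f y)) =
      (\<lambda>y. indicator {0<..} y *\<^sub>R f y)"
    using Gpos by simp
  ultimately have f_int: "set_integrable lborel {0<..} f"
    unfolding set_integrable_def by simp
  have lim0: "(F \<longlongrightarrow> 0) (at_right 0)"
  proof (rule Lim_null_comparison)
    show "\<forall>\<^sub>F y in at_right 0. norm (F y) \<le> y powr \<nu> * exp (- y)"
      by (auto simp: F_def)
    have "((\<lambda>y. y powr \<nu> * exp (- y)) \<longlongrightarrow> 0 powr \<nu> * exp (- 0)) (at_right 0)"
      using nu by (intro tendsto_intros) (auto simp: eventually_at_right_less less_imp_le intro: eventually_mono[OF eventually_at_right_less])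
    then show "((\<lambda>y. y powr \<nu> * exp (- y)) \<longlongrightarrow> 0) (at_right 0)" by simp
  qed
  have lim_infty: "(F \<longlongrightarrow> 0) at_top"
  proof (rule Lim_null_comparison)
    show "\<forall>\<^sub>F y in at_top. norm (F y) \<le> y powr \<nu> * exp (- y)"
      by (auto simp: F_def)
    show "((\<lambda>y. y powr \<nu> * exp (- y)) \<longlongrightarrow> 0) at_top"
      by real_asymp
  qed
  have "(LBINT y=0..\<infinity>. f y) = 0 - 0"
  proof (rule interval_integral_FTC_integrable)
    show "((F \<circ> real_of_ereal) \<longlongrightarrow> 0) (at_right 0)"
      using lim0 by (simp add: ereal_tendsto_simps zero_ereal_def)
    show "((F \<circ> real_of_ereal) \<longlongrightarrow> 0) (at_left \<infinity>)"
      using lim_infty by (simp add: ereal_tendsto_simps)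
    show "set_integrable lborel (einterval 0 \<infinity>) f"
      using f_int by (simp add: zero_ereal_def)
    show "isCont f x" if "0 < ereal x" for x
      using that unfolding f_def by (intro continuous_intros) auto
    show "(F has_vector_derivative f x) (at x)" if "0 < ereal x" for x
      using that by (intro F') auto
  qed simp
  then have "(\<integral>y. indicator {0<..} y *\<^sub>R f y \<partial>lborel) = 0"
    by (simp add: interval_lebesgue_integral_0_infty set_lebesgue_integral_def)
  then have "(\<integral>y. gamma_density \<nu> y *\<^sub>R ((\<nu> - y + \<i> * s * y) * iexp (s * y)) \<partial>lborel) = 0"
    unfolding density using f_int
    by (subst Bochner_Integration.integral_scaleR_right) (simp_all add: set_integrable_def)
  then have "(CLINT x|gamma_distribution \<nu>. (\<nu> - x + \<i> * s * x) * iexp (s * x)) = 0"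
    unfolding gamma_distribution_def
    by (subst integral_density) (auto simp: gamma_density_nonneg nu)
  then have "\<nu> * (CLINT x|gamma_distribution \<nu>. iexp (s * x)) - (CLINT x|gamma_distribution \<nu>. x * iexp (s * x))
     + \<i> * s * (CLINT x|gamma_distribution \<nu>. x * iexp (s * x)) = 0"
    unfolding integrand using int1 int2 by simp
  moreover have "(CLINT x|gamma_distribution \<nu>. (x - \<nu>) * iexp (s * x)) =
     (CLINT x|gamma_distribution \<nu>. x * iexp (s * x)) - \<nu> * (CLINT x|gamma_distribution \<nu>. iexp (s * x))"
    using int1 int2 by (simp add: left_diff_distrib)
  moreover have "z = u * b" if "c * a - b + u * b = 0" "z = b - c * a" for z u b c a :: complex
    using that by algebra
  ultimately show ?thesis by blast
qed

text \<open>
  This identifies the limit of the moment expression once the centred moments are known to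
  converge to those of the Gamma law.
\<close>
lemma gamma_centered_moment_combination:
  assumes nu: "\<nu> > 0"
  shows "(\<integral>x. (x - \<nu>)^4 \<partial>gamma_distribution \<nu>) - 6 * (\<integral>x. (x - \<nu>)^3 \<partial>gamma_distribution \<nu>)
    + 6 * (1 - \<nu>) * (\<integral>x. (x - \<nu>)^2 \<partial>gamma_distribution \<nu>) + 3 * \<nu>\<^sup>2 = 0"
proof -
  interpret G: real_distribution "gamma_distribution \<nu>" using nu by (rule real_distribution_gamma)
  have int: "integrable (gamma_distribution \<nu>) (\<lambda>x. x ^ k)"
    and val: "(\<integral>x. x ^ k \<partial>gamma_distribution \<nu>) = pochhammer \<nu> k" for k
    using gamma_distribution_moment[OF nu] by (auto simp: has_bochner_integral_iff)
  note int' = int int[of 1, simplified] and val' = val val[of 1, simplified]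
  have 2: "(\<integral>x. (x - \<nu>)^2 \<partial>gamma_distribution \<nu>) = \<nu>"
  proof -
    have "(\<lambda>x. (x - \<nu>)^2) = (\<lambda>x. x^2 - 2 * \<nu> * x + \<nu>^2)" by (auto simp: power2_eq_square algebra_simps)
    then have "(\<integral>x. (x - \<nu>)^2 \<partial>gamma_distribution \<nu>) = pochhammer \<nu> 2 - 2 * \<nu> * \<nu> + \<nu>^2"
      using int' G.prob_space by (simp add: val' del: G.space_eq_univ)
    also have "\<dots> = \<nu>"
      by (simp add: pochhammer_Suc numeral_eq_Suc algebra_simps)
    finally show ?thesis .
  qed
  have 3: "(\<integral>x. (x - \<nu>)^3 \<partial>gamma_distribution \<nu>) = 2 * \<nu>"
  proof -
    have "(\<lambda>x. (x - \<nu>)^3) = (\<lambda>x. x^3 - 3 * \<nu> * x^2 + 3 * \<nu>^2 * x - \<nu>^3)"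
      by (auto simp: numeral_eq_Suc algebra_simps)
    then have "(\<integral>x. (x - \<nu>)^3 \<partial>gamma_distribution \<nu>) = pochhammer \<nu> 3 - 3 * \<nu> * pochhammer \<nu> 2 + 3 * \<nu>^2 * \<nu> - \<nu>^3"
      using int' G.prob_space by (simp add: val' del: G.space_eq_univ)
    also have "\<dots> = 2 * \<nu>"
      by (simp add: pochhammer_Suc numeral_eq_Suc algebra_simps)
    finally show ?thesis .
  qed
  have 4: "(\<integral>x. (x - \<nu>)^4 \<partial>gamma_distribution \<nu>) = 3 * \<nu>^2 + 6 * \<nu>"
  proof -
    have "(\<lambda>x. (x - \<nu>)^4) = (\<lambda>x. x^4 - 4 * \<nu> * x^3 + 6 * \<nu>^2 * x^2 - 4 * \<nu>^3 * x + \<nu>^4)"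
      by (auto simp: numeral_eq_Suc algebra_simps)
    then have "(\<integral>x. (x - \<nu>)^4 \<partial>gamma_distribution \<nu>) = pochhammer \<nu> 4 - 4 * \<nu> * pochhammer \<nu> 3 + 6 * \<nu>^2 * pochhammer \<nu> 2 - 4 * \<nu>^3 * \<nu> + \<nu>^4"
      using int' G.prob_space by (simp add: val' del: G.space_eq_univ)
    also have "\<dots> = 3 * \<nu>^2 + 6 * \<nu>"
      by (simp add: pochhammer_Suc numeral_eq_Suc algebra_simps)
    finally show ?thesis .
  qed
  show ?thesis unfolding 2 3 4 by (simp add: power2_eq_square algebra_simps)
qed

lemma one_minus_i_times_nonzero: "1 - \<i> * complex_of_real t \<noteq> 0"
  by (auto simp: complex_eq_iff)

text \<open>
  The Gamma law satisfies the Stein identity exactly, so the general estimate applies with error \<open>0\<close>.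
\<close>
lemma char_gamma_distribution:
  assumes nu: "\<nu> > 0"
  shows "char (gamma_distribution \<nu>) t * (1 - \<i> * t) powr \<nu> = 1"
proof -
  interpret Ga: real_distribution "gamma_distribution \<nu>" using nu by (rule real_distribution_gamma)
  have "norm ((CLINT x|gamma_distribution \<nu>. iexp (t * x)) * (1 - \<i> * t) powr \<nu> - 1)
           \<le> 0 * t\<^sup>2 * (1 + \<bar>t\<bar>) powr \<nu>"
  proof (rule Ga.approximate_Stein_identity_imp_char_close)
    show "integrable (gamma_distribution \<nu>) (\<lambda>x. x\<^sup>2)"
      using gamma_distribution_moment[OF nu, of 2] by (simp add: has_bochner_integral_iff)
    show "norm ((CLINT x|gamma_distribution \<nu>. (x - \<nu>) * iexp (s * x)) -
                  \<i> * s * (CLINT x|gamma_distribution \<nu>. x * iexp (s * x))) \<le> 0 * \<bar>s\<bar>" for s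
      unfolding gamma_Stein_identity[OF nu] by simp
  qed (use nu in auto)
  then show ?thesis by (simp add: char_def)
qed

section \<open>Square-integrable functions and orthogonal sums\<close>

lemma L2D: "f \<in> L2 M \<Longrightarrow> f \<in> borel_measurable M" "f \<in> L2 M \<Longrightarrow> integrable M (\<lambda>x. (f x)\<^sup>2)"
  by (auto simp: L2_def)

lemma integrable_L2_mult:
  assumes "f \<in> L2 M" "g \<in> L2 M"
  shows "integrable M (\<lambda>x. f x * g x)"
proof (rule Bochner_Integration.integrable_bound)
  show "integrable M (\<lambda>x. (f x)\<^sup>2 + (g x)\<^sup>2)" using assms by (auto simp: L2_def)
  show "(\<lambda>x. f x * g x) \<in> borel_measurable M" using assms by (auto simp: L2_def)
  have "\<bar>a * b\<bar> \<le> a\<^sup>2 + b\<^sup>2" for a b :: real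
  proof -
    have "2 * (\<bar>a\<bar> * \<bar>b\<bar>) \<le> a\<^sup>2 + b\<^sup>2"
      using zero_le_power2[of "\<bar>a\<bar> - \<bar>b\<bar>"] by (simp add: power2_diff)
    then show ?thesis by (simp add: abs_mult) (smt (verit) mult_nonneg_nonneg abs_ge_zero)
  qed
  then show "AE x in M. norm (f x * g x) \<le> norm ((f x)\<^sup>2 + (g x)\<^sup>2)"
    by (auto intro: order_trans)
qed

lemma L2_lincomb:
  assumes "f \<in> L2 M" "g \<in> L2 M"
  shows "(\<lambda>x. a * f x + b * g x) \<in> L2 M"
proof -
  have "(\<lambda>x. (a * f x + b * g x)\<^sup>2) = (\<lambda>x. a\<^sup>2 * (f x)\<^sup>2 + b\<^sup>2 * (g x)\<^sup>2 + 2 * a * b * (f x * g x))"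
    by (auto simp: power2_eq_square algebra_simps)
  then show ?thesis
    using assms integrable_L2_mult[OF assms] by (auto simp: L2_def)
qed

lemma orthogonal_sum_inner:
  fixes g :: "nat \<Rightarrow> 'a \<Rightarrow> real"
  assumes I: "finite I" and g: "\<And>k. k \<in> I \<Longrightarrow> g k \<in> L2 M"
    and orth: "\<And>j k. j \<in> I \<Longrightarrow> k \<in> I \<Longrightarrow> j \<noteq> k \<Longrightarrow> L2_inner M (g j) (g k) = 0"
  shows "(\<integral>x. (\<Sum>k\<in>I. a k * g k x) * (\<Sum>k\<in>I. b k * g k x) \<partial>M) =
         (\<Sum>k\<in>I. a k * b k * (\<integral>x. (g k x)\<^sup>2 \<partial>M))"
proof -
  have int: "integrable M (\<lambda>x. g j x * g k x)" if "j \<in> I" "k \<in> I" for j k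
    using g that by (intro integrable_L2_mult)
  have "(\<integral>x. (\<Sum>k\<in>I. a k * g k x) * (\<Sum>k\<in>I. b k * g k x) \<partial>M) =
        (\<integral>x. (\<Sum>j\<in>I. \<Sum>k\<in>I. a j * b k * (g j x * g k x)) \<partial>M)"
    by (simp add: sum_product mult_ac)
  also have "\<dots> = (\<Sum>j\<in>I. \<integral>x. (\<Sum>k\<in>I. a j * b k * (g j x * g k x)) \<partial>M)"
    using int by (intro Bochner_Integration.integral_sum Bochner_Integration.integrable_sum integrable_mult_right)
  also have "\<dots> = (\<Sum>j\<in>I. \<Sum>k\<in>I. \<integral>x. a j * b k * (g j x * g k x) \<partial>M)"
    using int by (intro sum.cong refl Bochner_Integration.integral_sum integrable_mult_right)
  also have "\<dots> = (\<Sum>j\<in>I. \<Sum>k\<in>I. if j = k then a j * b k * (\<integral>x. (g k x)\<^sup>2 \<partial>M) else 0)"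
    using orth by (intro sum.cong refl) (auto simp: L2_inner_def power2_eq_square)
  also have "\<dots> = (\<Sum>k\<in>I. a k * b k * (\<integral>x. (g k x)\<^sup>2 \<partial>M))"
    using I by (intro sum.cong refl) (simp add: sum.delta')
  finally show ?thesis .
qed

section \<open>Trigonometric test functions\<close>

text \<open>
  The test functions to which the diffusion property is applied. They have bounded derivatives,
  and for a fixed frequency the family is closed under differentiation, which makes its members
  smooth by induction on the order.
\<close>
definition trig :: "real \<Rightarrow> real \<Rightarrow> real \<Rightarrow> real \<Rightarrow> real" where
  "trig t a b x = a * sin (t * x) + b * cos (t * x)"

lemma deriv_trig: "deriv (trig t a b) = trig t (- b * t) (a * t)"
proof
  fix x
  have "(trig t a b has_field_derivative trig t (- b * t) (a * t) x) (at x)"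
    unfolding trig_def[abs_def] by (auto intro!: derivative_eq_intros simp: algebra_simps)
  then show "deriv (trig t a b) x = trig t (- b * t) (a * t) x" by (rule DERIV_imp_deriv)
qed

lemma trig_bound: "\<bar>trig t a b x\<bar> \<le> \<bar>a\<bar> + \<bar>b\<bar>"
proof -
  have "\<bar>a * sin (t * x)\<bar> \<le> \<bar>a\<bar>" "\<bar>b * cos (t * x)\<bar> \<le> \<bar>b\<bar>"
    by (simp_all add: abs_mult mult_left_le)
  then show ?thesis unfolding trig_def by linarith
qed

lemma trig_measurable [measurable]: "trig t a b \<in> borel_measurable borel"
  unfolding trig_def[abs_def] by measurable

lemma smooth_fun_trig: "smooth_fun (trig t a b)"
proof -
  have "((deriv ^^ k) (trig t a b)) differentiable (at x)" for k x
  proof (induction k arbitrary: a b)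
    case 0
    have "(trig t a b has_field_derivative trig t (- b * t) (a * t) x) (at x)"
      unfolding trig_def[abs_def] by (auto intro!: derivative_eq_intros simp: algebra_simps)
    then show ?case by (auto simp: real_differentiable_def)
  next
    case (Suc k)
    then show ?case by (simp only: funpow_Suc_right o_apply deriv_trig)
  qed
  then show ?thesis by (simp add: smooth_fun_def)
qed

section \<open>The generator and its spectral decomposition\<close>

context diffusive_markov_generator
begin

abbreviation V :: "nat \<Rightarrow> ('a \<Rightarrow> real) set" where
  "V k \<equiv> Ker_shift M D L (lam k)"

lemma domain_subset_L2: "f \<in> D \<Longrightarrow> f \<in> L2 M"
  using self_adjoint_L by (auto simp: self_adjoint_def)

lemma L_in_L2: "f \<in> D \<Longrightarrow> L f \<in> L2 M"
proof -
  assume "f \<in> D"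
  then have "(\<lambda>x. - L f x) \<in> L2 M" using self_adjoint_L by (simp add: self_adjoint_def)
  then have "(\<lambda>x. (-1) * (- L f x) + 0 * (- L f x)) \<in> L2 M" by (intro L2_lincomb)
  then show ?thesis by simp
qed

lemma domain_lincomb:
  assumes "f \<in> D" "g \<in> D"
  shows "(\<lambda>x. a * f x + b * g x) \<in> D"
    and "AE x in M. L (\<lambda>x. a * f x + b * g x) x = a * L f x + b * L g x"
proof -
  have "(\<lambda>x. a * f x + b * g x) \<in> D \<and>
        (AE x in M. - L (\<lambda>x. a * f x + b * g x) x = a * (- L f x) + b * (- L g x))"
    using self_adjoint_L assms unfolding self_adjoint_def by blast
  then show "(\<lambda>x. a * f x + b * g x) \<in> D"
    and "AE x in M. L (\<lambda>x. a * f x + b * g x) x = a * L f x + b * L g x"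
    by (auto elim!: AE_mp)
qed

text \<open>
  The adjoint has the same domain as the operator; this is the source of symmetry and of the
  compatibility of \<open>L\<close> with equality almost everywhere.
\<close>
lemma adjoint_characterization:
  assumes "f \<in> L2 M" "h \<in> L2 M"
  shows "(f \<in> D \<and> (AE x in M. - L f x = h x)) \<longleftrightarrow>
         (\<forall>g\<in>D. L2_inner M f (\<lambda>x. - L g x) = L2_inner M h g)"
  using self_adjoint_L assms unfolding self_adjoint_def by blast

lemma uminus_L_in_L2: "f \<in> D \<Longrightarrow> (\<lambda>x. - L f x) \<in> L2 M"
  using self_adjoint_L by (simp add: self_adjoint_def)

lemma L_symmetric:
  assumes "f \<in> D" "g \<in> D"
  shows "(\<integral>x. f x * L g x \<partial>M) = (\<integral>x. L f x * g x \<partial>M)"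
proof -
  have "L2_inner M f (\<lambda>x. - L g x) = L2_inner M (\<lambda>x. - L f x) g"
    using adjoint_characterization[OF domain_subset_L2 uminus_L_in_L2, of f f] assms by simp
  then show ?thesis by (simp add: L2_inner_def)
qed

lemma domain_AE_cong:
  assumes f: "f \<in> D" and f': "f' \<in> L2 M" and eq: "AE x in M. f x = f' x"
  shows "f' \<in> D" and "AE x in M. L f' x = L f x"
proof -
  have "L2_inner M f' (\<lambda>x. - L g x) = L2_inner M (\<lambda>x. - L f x) g" if "g \<in> D" for g
  proof -
    have [measurable]: "f \<in> borel_measurable M" "f' \<in> borel_measurable M" "L g \<in> borel_measurable M"
      using f f' that domain_subset_L2 L_in_L2 L2D by blast+
    have "L2_inner M f' (\<lambda>x. - L g x) = L2_inner M f (\<lambda>x. - L g x)"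
      unfolding L2_inner_def by (rule integral_cong_AE) (use eq in auto)
    also have "\<dots> = L2_inner M (\<lambda>x. - L f x) g"
      using L_symmetric[OF f that] by (simp add: L2_inner_def)
    finally show ?thesis .
  qed
  then have "f' \<in> D \<and> (AE x in M. - L f' x = - L f x)"
    using adjoint_characterization[OF f' uminus_L_in_L2[OF f]] by blast
  then show "f' \<in> D" and "AE x in M. L f' x = L f x" by auto
qed

lemma expectation_L_eq_0: "f \<in> D \<Longrightarrow> (\<integral>x. L f x \<partial>M) = 0"
proof -
  assume f: "f \<in> D"
  have [measurable]: "f \<in> borel_measurable M" "L (\<lambda>_. 1) \<in> borel_measurable M"
    using f one_in_domain domain_subset_L2 L_in_L2 L2D by blast+
  have "(\<integral>x. L f x * 1 \<partial>M) = (\<integral>x. f x * L (\<lambda>_. 1) x \<partial>M)"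
    by (rule L_symmetric[symmetric]) (use f one_in_domain in auto)
  also have "\<dots> = (\<integral>x. 0 \<partial>M)"
    by (rule integral_cong_AE) (use L_one in auto)
  finally show ?thesis by simp
qed

lemma eigenspaceD:
  assumes "f \<in> V k"
  shows "f \<in> D" "AE x in M. L f x = - lam k * f x"
  using assms by (auto simp: Ker_shift_def elim!: AE_mp)

lemma eigenspace_lincomb:
  assumes "f \<in> V k" "g \<in> V k"
  shows "(\<lambda>x. a * f x + b * g x) \<in> V k"
  using domain_lincomb[OF eigenspaceD(1)[OF assms(1)] eigenspaceD(1)[OF assms(2)], of a b]
    eigenspaceD(2)[OF assms(1)] eigenspaceD(2)[OF assms(2)]
  by (auto simp: Ker_shift_def algebra_simps)

lemma const_in_eigenspace_0: "(\<lambda>_. c) \<in> V 0"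
proof -
  have "(\<lambda>_. 1) \<in> V 0" using one_in_domain L_one lam_0 by (auto simp: Ker_shift_def)
  from eigenspace_lincomb[OF this this, of c 0] show ?thesis by simp
qed

lemma L_sum_eigenvectors:
  assumes g: "\<And>k. k \<le> m \<Longrightarrow> g k \<in> V k" and n: "n \<le> m"
  shows "(\<lambda>x. \<Sum>k\<le>n. g k x) \<in> D \<and> (AE x in M. L (\<lambda>x. \<Sum>k\<le>n. g k x) x = (\<Sum>k\<le>n. - lam k * g k x))"
  using n
proof (induction n)
  case 0
  then show ?case using g[of 0] eigenspaceD[of "g 0" 0] by simp
next
  case (Suc n)
  then have IH: "(\<lambda>x. \<Sum>k\<le>n. g k x) \<in> D"
      "AE x in M. L (\<lambda>x. \<Sum>k\<le>n. g k x) x = (\<Sum>k\<le>n. - lam k * g k x)" by auto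
  have gS: "g (Suc n) \<in> V (Suc n)" using g Suc by auto
  show ?case
    using domain_lincomb[OF IH(1) eigenspaceD(1)[OF gS], of 1 1] eigenspaceD(2)[OF gS] IH(2)
    by auto
qed

lemma direct_sum_domain:
  assumes "u \<in> direct_sum_upto M V m"
  shows "u \<in> D"
proof -
  from assms obtain g where u: "u \<in> L2 M" and g: "\<And>k. k \<le> m \<Longrightarrow> g k \<in> V k"
    and eq: "AE x in M. u x = (\<Sum>k\<le>m. g k x)"
    unfolding direct_sum_upto_def by blast
  have "(\<lambda>x. \<Sum>k\<le>m. g k x) \<in> D" using L_sum_eigenvectors[OF g, of m] by simp
  then show ?thesis by (rule domain_AE_cong(1)[OF _ u]) (use eq in auto)
qed

lemma zero_in_eigenspace: "(\<lambda>_. 0) \<in> V k"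
  using domain_lincomb[OF one_in_domain one_in_domain, of 0 0] by (simp add: Ker_shift_def)

lemma eigenspace_subset_direct_sum:
  assumes "f \<in> V k" "k \<le> m"
  shows "f \<in> direct_sum_upto M V m"
proof -
  let ?g = "\<lambda>j. if j = k then f else (\<lambda>_. 0)"
  have "f x = (\<Sum>j\<le>m. ?g j x)" for x
    using assms(2) by (simp add: if_distribR sum.delta')
  moreover have "?g j \<in> V j" for j using assms(1) zero_in_eigenspace by simp
  ultimately show ?thesis
    using domain_subset_L2[OF eigenspaceD(1)[OF assms(1)]] unfolding direct_sum_upto_def
    by (intro CollectI conjI exI[of _ ?g]) auto
qed

lemma direct_sum_lincomb:
  assumes "u \<in> direct_sum_upto M V m" "v \<in> direct_sum_upto M V m"
  shows "(\<lambda>x. a * u x + b * v x) \<in> direct_sum_upto M V m"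
proof -
  obtain g h where g: "\<And>k. k \<le> m \<Longrightarrow> g k \<in> V k" "AE x in M. u x = (\<Sum>k\<le>m. g k x)"
    and h: "\<And>k. k \<le> m \<Longrightarrow> h k \<in> V k" "AE x in M. v x = (\<Sum>k\<le>m. h k x)"
    using assms unfolding direct_sum_upto_def by blast
  have "AE x in M. a * u x + b * v x = (\<Sum>k\<le>m. a * g k x + b * h k x)"
    using g(2) h(2) by eventually_elim (simp add: sum.distrib sum_distrib_left)
  moreover have "(\<lambda>x. a * g k x + b * h k x) \<in> V k" if "k \<le> m" for k
    using that g(1) h(1) by (intro eigenspace_lincomb)
  ultimately show ?thesis
    using assms L2_lincomb[of u M v a b] unfolding direct_sum_upto_def
    by (intro CollectI conjI exI[of _ "\<lambda>k x. a * g k x + b * h k x"]) auto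
qed

text \<open>
  On the \<open>k\<close>-th component, \<open>c + L\<close> is multiplication by \<open>c - lam k\<close>, and
  \<open>(c - lam k)\<^sup>2 \<le> c (c - lam k)\<close> because \<open>0 \<le> c - lam k \<le> c\<close>. Orthogonality of the eigenspaces
  reduces the claim to these scalar inequalities.
\<close>
lemma spectral_inequality:
  assumes u: "u \<in> direct_sum_upto M V m" and c: "lam m \<le> c"
  shows "(\<integral>x. (c * u x + L u x)\<^sup>2 \<partial>M) \<le> c * (\<integral>x. u x * (c * u x + L u x) \<partial>M)"
proof -
  from u obtain g where uL2: "u \<in> L2 M" and g: "\<And>k. k \<le> m \<Longrightarrow> g k \<in> V k"
    and eq: "AE x in M. u x = (\<Sum>k\<le>m. g k x)"
    unfolding direct_sum_upto_def by blast
  define s where "s = (\<lambda>x. \<Sum>k\<le>m. g k x)"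
  have s: "s \<in> D" "AE x in M. L s x = (\<Sum>k\<le>m. - lam k * g k x)"
    using L_sum_eigenvectors[OF g, of m] by (auto simp: s_def)
  have Lu: "AE x in M. L u x = L s x"
    by (rule domain_AE_cong(2)[OF s(1) uL2]) (use eq in \<open>auto simp: s_def\<close>)
  have gL2: "g k \<in> L2 M" if "k \<le> m" for k
    using g[OF that] eigenspaceD(1) domain_subset_L2 by blast
  have [measurable]: "u \<in> borel_measurable M" "L u \<in> borel_measurable M"
    using uL2 L2D(1) L_in_L2[OF direct_sum_domain[OF u]] by blast+
  have gm[measurable]: "g k \<in> borel_measurable M" if "k \<in> {..m}" for k
    using gL2 that L2D(1) by blast
  have AE1: "AE x in M. c * u x + L u x = (\<Sum>k\<le>m. (c - lam k) * g k x)"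
    using eq Lu s(2)
    by eventually_elim (simp add: sum_distrib_left sum_subtractf sum_negf left_diff_distrib)
  have AE2: "AE x in M. u x = (\<Sum>k\<le>m. 1 * g k x)" using eq by simp
  have orth: "L2_inner M (g j) (g k) = 0" if "j \<in> {..m}" "k \<in> {..m}" "j \<noteq> k" for j k
    using eigenspaces_orthogonal g that unfolding orthogonal_family_def by auto
  have inner: "(\<integral>x. (\<Sum>k\<le>m. 1 * g k x) * (\<Sum>k\<le>m. (c - lam k) * g k x) \<partial>M) =
      (\<Sum>k\<le>m. 1 * (c - lam k) * (\<integral>x. (g k x)\<^sup>2 \<partial>M))"
    by (rule orthogonal_sum_inner) (use gL2 orth in auto)
  have "(\<integral>x. (c * u x + L u x)\<^sup>2 \<partial>M) =
      (\<integral>x. (\<Sum>k\<le>m. (c - lam k) * g k x) * (\<Sum>k\<le>m. (c - lam k) * g k x) \<partial>M)"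
    by (rule integral_cong_AE) (use AE1 in \<open>auto simp: power2_eq_square\<close>)
  also have "\<dots> = (\<Sum>k\<le>m. (c - lam k) * (c - lam k) * (\<integral>x. (g k x)\<^sup>2 \<partial>M))"
    by (rule orthogonal_sum_inner) (use gL2 orth in auto)
  also have "\<dots> \<le> (\<Sum>k\<le>m. c * (1 * (c - lam k) * (\<integral>x. (g k x)\<^sup>2 \<partial>M)))"
  proof (rule sum_mono)
    fix k assume k: "k \<in> {..m}"
    have nonneg: "0 \<le> lam k" using lam_0 strict_mono_less_eq[OF lam_strict_mono, of 0 k] by simp
    have le: "lam k \<le> c" using c k strict_mono_less_eq[OF lam_strict_mono, of k m] by simp
    have "(c - lam k) * (c - lam k) \<le> c * (c - lam k)"
      by (rule mult_right_mono) (use nonneg le in auto)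
    then have "(c - lam k) * (c - lam k) * (\<integral>x. (g k x)\<^sup>2 \<partial>M) \<le> c * (c - lam k) * (\<integral>x. (g k x)\<^sup>2 \<partial>M)"
      by (rule mult_right_mono) simp
    then show "(c - lam k) * (c - lam k) * (\<integral>x. (g k x)\<^sup>2 \<partial>M) \<le> c * (1 * (c - lam k) * (\<integral>x. (g k x)\<^sup>2 \<partial>M))"
      by (simp add: mult_ac)
  qed
  also have "\<dots> = c * (\<integral>x. (\<Sum>k\<le>m. 1 * g k x) * (\<Sum>k\<le>m. (c - lam k) * g k x) \<partial>M)"
    unfolding inner by (simp only: sum_distrib_left)
  also have "(\<integral>x. (\<Sum>k\<le>m. 1 * g k x) * (\<Sum>k\<le>m. (c - lam k) * g k x) \<partial>M) =
      (\<integral>x. u x * (c * u x + L u x) \<partial>M)"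
    by (rule integral_cong_AE) (use AE1 AE2 in auto)
  finally show ?thesis .
qed

end

section \<open>Chaos eigenfunctions\<close>

context diffusive_markov_generator
begin

context
  fixes p :: nat and X :: "'a \<Rightarrow> real"
  assumes p: "p \<ge> 1" and chaos: "chaos_eigenfunction M D L lam p X"
begin

abbreviation G :: "'a \<Rightarrow> real" where "G \<equiv> carre_du_champ L X X"

lemma chaos_eigenspace: "X \<in> V p"
  using chaos by (simp add: chaos_eigenfunction_def)

lemmas chaos_domain = eigenspaceD(1)[OF chaos_eigenspace]
lemmas chaos_L = eigenspaceD(2)[OF chaos_eigenspace]

lemma chaos_square: "(\<lambda>x. (X x)\<^sup>2) \<in> direct_sum_upto M V (2 * p)"
  using chaos by (simp add: chaos_eigenfunction_def)

lemmas chaos_square_domain = direct_sum_domain[OF chaos_square]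
lemmas chaos_L2 = domain_subset_L2[OF chaos_domain]
lemmas chaos_square_L2 = domain_subset_L2[OF chaos_square_domain]

lemma chaos_measurable [measurable]:
  "X \<in> borel_measurable M" "L X \<in> borel_measurable M" "L (\<lambda>x. (X x)\<^sup>2) \<in> borel_measurable M"
  using chaos_domain chaos_square_domain L_in_L2 L2D(1) domain_subset_L2 by blast+

text \<open>
  Since \<open>L X = - \<lambda> X\<close>, the definition of \<open>\<Gamma>\<close> reduces to \<open>G = (L + 2\<lambda>)(X\<^sup>2) / 2\<close>. The chaos
  property puts \<open>X\<^sup>2\<close> into the domain of \<open>L\<close>, so \<open>G\<close> is square-integrable.
\<close>
lemma carre_AE: "AE x in M. G x = (1 / 2) * L (\<lambda>x. (X x)\<^sup>2) x + lam p * (X x)\<^sup>2"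
  using chaos_L by eventually_elim (simp add: carre_du_champ_def power2_eq_square field_simps)

lemma carre_measurable [measurable]: "G \<in> borel_measurable M"
  using chaos_measurable unfolding carre_du_champ_def power2_eq_square by measurable

lemma carre_L2: "G \<in> L2 M"
proof -
  define H where "H = (\<lambda>x. (1 / 2) * L (\<lambda>x. (X x)\<^sup>2) x + lam p * (X x)\<^sup>2)"
  have "H \<in> L2 M" unfolding H_def
    by (rule L2_lincomb[OF L_in_L2[OF chaos_square_domain] chaos_square_L2])
  then have H: "H \<in> borel_measurable M" "integrable M (\<lambda>x. (H x)\<^sup>2)" by (auto dest: L2D)
  have "integrable M (\<lambda>x. (G x)\<^sup>2) = integrable M (\<lambda>x. (H x)\<^sup>2)"
    by (rule integrable_cong_AE) (use H carre_AE in \<open>auto simp: H_def\<close>)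
  then show ?thesis using H by (simp add: L2_def)
qed

lemma one_L2: "(\<lambda>_. 1) \<in> L2 M"
  by (rule domain_subset_L2[OF one_in_domain])

lemma chaos_integrable:
  "integrable M X" "integrable M (\<lambda>x. X x ^ 2)" "integrable M (\<lambda>x. X x ^ 3)" "integrable M (\<lambda>x. X x ^ 4)"
  "integrable M G" "integrable M (\<lambda>x. X x * G x)" "integrable M (\<lambda>x. X x ^ 2 * G x)"
  using integrable_L2_mult[OF chaos_L2 one_L2] integrable_L2_mult[OF chaos_L2 chaos_L2]
    integrable_L2_mult[OF chaos_L2 chaos_square_L2] integrable_L2_mult[OF chaos_square_L2 chaos_square_L2]
    integrable_L2_mult[OF carre_L2 one_L2]
    integrable_L2_mult[OF chaos_L2 carre_L2] integrable_L2_mult[OF chaos_square_L2 carre_L2]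
  by (simp_all add: numeral_eq_Suc mult_ac)

lemma lam_p_pos: "lam p > 0"
  using p strict_mono_less[OF lam_strict_mono, of 0 p] lam_0 by simp

lemma chaos_centered: "(\<integral>x. X x \<partial>M) = 0"
proof -
  have "0 = (\<integral>x. L X x \<partial>M)" using expectation_L_eq_0[OF chaos_domain] by simp
  also have "\<dots> = (\<integral>x. - lam p * X x \<partial>M)"
    by (rule integral_cong_AE) (use chaos_L in auto)
  finally show ?thesis using lam_p_pos by simp
qed

text \<open>
  The integrals of \<open>X\<^sup>k G\<close> for \<open>k = 0, 1, 2\<close> follow the pattern \<open>\<lambda> E[X\<^sup>k\<^sup>+\<^sup>2] / (k + 1)\<close> of integration
  by parts. For \<open>k \<le> 1\<close> the explicit form of \<open>G\<close> and the symmetry of \<open>L\<close> suffice.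
\<close>
lemma carre_expectation: "(\<integral>x. G x \<partial>M) = lam p * (\<integral>x. X x ^ 2 \<partial>M)"
proof -
  have i: "integrable M (L (\<lambda>x. (X x)\<^sup>2))"
    using integrable_L2_mult[OF L_in_L2[OF chaos_square_domain] one_L2] by simp
  have "(\<integral>x. G x \<partial>M) = (\<integral>x. (1 / 2) * L (\<lambda>x. (X x)\<^sup>2) x + lam p * (X x)\<^sup>2 \<partial>M)"
    by (rule integral_cong_AE) (use carre_AE in auto)
  also have "\<dots> = lam p * (\<integral>x. X x ^ 2 \<partial>M)"
    using i chaos_integrable(2) expectation_L_eq_0[OF chaos_square_domain] by simp
  finally show ?thesis .
qed

lemma carre_first_moment: "(\<integral>x. X x * G x \<partial>M) = lam p / 2 * (\<integral>x. X x ^ 3 \<partial>M)"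
proof -
  have i: "integrable M (\<lambda>x. X x * L (\<lambda>x. (X x)\<^sup>2) x)"
    by (rule integrable_L2_mult[OF chaos_L2 L_in_L2[OF chaos_square_domain]])
  have "(\<integral>x. X x * L (\<lambda>x. (X x)\<^sup>2) x \<partial>M) = (\<integral>x. L X x * (X x)\<^sup>2 \<partial>M)"
    by (rule L_symmetric[OF chaos_domain chaos_square_domain])
  also have "\<dots> = (\<integral>x. - lam p * X x ^ 3 \<partial>M)"
    by (rule integral_cong_AE) (use chaos_L in \<open>auto simp: numeral_eq_Suc mult_ac\<close>)
  also have "\<dots> = - lam p * (\<integral>x. X x ^ 3 \<partial>M)" by simp
  finally have *: "(\<integral>x. X x * L (\<lambda>x. (X x)\<^sup>2) x \<partial>M) = - lam p * (\<integral>x. X x ^ 3 \<partial>M)" .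
  have "(\<integral>x. X x * G x \<partial>M) = (\<integral>x. (1 / 2) * (X x * L (\<lambda>x. (X x)\<^sup>2) x) + lam p * X x ^ 3 \<partial>M)"
  proof (rule integral_cong_AE)
    show "AE x in M. X x * G x = (1 / 2) * (X x * L (\<lambda>x. (X x)\<^sup>2) x) + lam p * X x ^ 3"
      using carre_AE by eventually_elim (simp add: power2_eq_square power3_eq_cube algebra_simps)
  qed measurable
  also have "\<dots> = lam p / 2 * (\<integral>x. X x ^ 3 \<partial>M)"
    using i chaos_integrable(3) * by (simp add: field_simps)
  finally show ?thesis .
qed

text \<open>
  This is \<open>\<lambda> E[X f(X)] = E[f'(X) G]\<close>: integrate the chain rule for a primitive of \<open>f\<close> and use
  that \<open>L\<close> has mean zero. For \<open>t \<noteq> 0\<close> the primitive is again trigonometric; for \<open>t = 0\<close> the identity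
  says that \<open>X\<close> is centred.
\<close>
lemma trig_integration_by_parts:
  "lam p * (\<integral>x. X x * trig t a b (X x) \<partial>M) = (\<integral>x. trig t (- b * t) (a * t) (X x) * G x \<partial>M)"
proof (cases "t = 0")
  case True
  then show ?thesis using chaos_centered by (simp add: trig_def)
next
  case False
  define \<phi> where "\<phi> = trig t (b / t) (- a / t)"
  have d1: "deriv \<phi> = trig t a b" and d2: "deriv (deriv \<phi>) = trig t (- b * t) (a * t)"
    using False by (simp_all add: \<phi>_def deriv_trig)
  have bd: "bounded (range (trig t c d))" for c d
    unfolding bounded_iff by (rule exI[of _ "\<bar>c\<bar> + \<bar>d\<bar>"]) (auto simp: trig_bound)
  have sm: "smooth_fun \<phi>" unfolding \<phi>_def by (rule smooth_fun_trig)
  have X2: "(\<lambda>x. X x * X x) \<in> D" using chaos_square_domain by (simp add: power2_eq_square)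
  have chain_rule: "((\<lambda>x. \<phi> (X x)) \<in> D \<longrightarrow>
           (AE x in M. L (\<lambda>y. \<phi> (X y)) x =
              deriv \<phi> (X x) * L X x + deriv (deriv \<phi>) (X x) * G x)) \<and>
        (bounded (range (deriv \<phi>)) \<and> bounded (range (deriv (deriv \<phi>))) \<and> G \<in> L2 M \<longrightarrow>
           (\<lambda>x. \<phi> (X x)) \<in> D)"
    using diffusive_L[unfolded diffusive_def, THEN spec, THEN spec, THEN mp, of \<phi> X]
      sm chaos_domain X2 by simp
  have dom: "(\<lambda>x. \<phi> (X x)) \<in> D"
    using chain_rule[THEN conjunct2] bd[of a b] bd[of "- b * t" "a * t"] carre_L2 unfolding d2 unfolding d1 by simp
  have chain: "AE x in M. L (\<lambda>y. \<phi> (X y)) x =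
      trig t a b (X x) * L X x + trig t (- b * t) (a * t) (X x) * G x"
    using chain_rule[THEN conjunct1] dom unfolding d2 unfolding d1 by simp
  have [measurable]: "L (\<lambda>y. \<phi> (X y)) \<in> borel_measurable M"
    using L_in_L2[OF dom] by (rule L2D)
  have bdd: "integrable M (\<lambda>x. trig t c d (X x) * Z x)" if Z: "integrable M Z" for c d Z
  proof -
    have [measurable]: "Z \<in> borel_measurable M" using Z by auto
    have "integrable M (\<lambda>x. (\<bar>c\<bar> + \<bar>d\<bar>) * Z x)" using Z by simp
    then show ?thesis
      by (rule Bochner_Integration.integrable_bound)
        (auto simp: abs_mult intro!: mult_right_mono trig_bound[THEN order_trans])
  qed
  have "0 = (\<integral>x. L (\<lambda>y. \<phi> (X y)) x \<partial>M)" using expectation_L_eq_0[OF dom] by simp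
  also have "\<dots> = (\<integral>x. - lam p * (trig t a b (X x) * X x) + trig t (- b * t) (a * t) (X x) * G x \<partial>M)"
    by (rule integral_cong_AE) (use chain chaos_L in auto)
  also have "\<dots> = - lam p * (\<integral>x. trig t a b (X x) * X x \<partial>M) + (\<integral>x. trig t (- b * t) (a * t) (X x) * G x \<partial>M)"
    using bdd[OF chaos_integrable(1), of a b] bdd[OF chaos_integrable(5), of "- b * t" "a * t"]
    by simp
  finally show ?thesis by (simp add: mult.commute)
qed

text \<open>
  Formally this is integration by parts with \<open>f(x) = x\<^sup>3\<close>, but \<open>X\<^sup>4\<close> need not belong to the domain
  of \<open>L\<close>. Instead \<open>f\<close> is approximated by \<open>(sin (tx) / t)\<^sup>3\<close>, a combination of sine functions with
  frequencies \<open>t\<close> and \<open>3t\<close>. As \<open>t\<close> tends to \<open>0\<close>, this function and its derivative converge, and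
  they are dominated by \<open>\<bar>x\<bar>\<^sup>3\<close> and \<open>3x\<^sup>2\<close>.
\<close>
lemma carre_second_moment: "(\<integral>x. X x ^ 2 * G x \<partial>M) = lam p / 3 * (\<integral>x. X x ^ 4 \<partial>M)"
proof -
  have sin3: "sin (3 * y) = 3 * sin y - 4 * sin y ^ 3" for y :: real
  proof -
    have "sin (3 * y) = sin (2 * y + y)" by simp
    also have "\<dots> = 2 * sin y * (cos y)\<^sup>2 + ((cos y)\<^sup>2 - (sin y)\<^sup>2) * sin y"
      unfolding sin_add sin_double cos_double by (simp add: power2_eq_square)
    also have "\<dots> = 3 * sin y - 4 * sin y ^ 3"
      unfolding cos_squared_eq by (simp add: power2_eq_square power3_eq_cube algebra_simps)
    finally show ?thesis .
  qed
  have approx: "lam p * (\<integral>x. X x * (sin (t * X x) / t) ^ 3 \<partial>M) =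
      (\<integral>x. 3 * ((sin (t * X x) / t)\<^sup>2 * cos (t * X x)) * G x \<partial>M)" if t: "t \<noteq> 0" for t
  proof -
    have int: "integrable M (\<lambda>x. Z x * trig s a b (X x))" if Z: "integrable M Z" for s a b Z
    proof -
      have [measurable]: "Z \<in> borel_measurable M" using Z by auto
      have "integrable M (\<lambda>x. Z x * (\<bar>a\<bar> + \<bar>b\<bar>))" using Z by simp
      then show ?thesis
        by (rule Bochner_Integration.integrable_bound)
          (auto simp: abs_mult intro!: mult_left_mono trig_bound[THEN order_trans])
    qed
    \<comment> \<open>Coefficients of \<open>sin (ty)\<close> and \<open>sin (3ty)\<close> in the expansion of \<open>(sin (ty) / t)\<^sup>3\<close>.\<close>
    define a where "a = 3 / (4 * t ^ 3)"
    define b where "b = - 1 / (4 * t ^ 3)"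
    have 1: "(sin (t * y) / t) ^ 3 = trig t a 0 y + trig (3 * t) b 0 y" for y
      using t sin3[of "t * y"]
      by (simp add: trig_def a_def b_def field_simps power3_eq_cube)
    have 2: "3 * ((sin (t * y) / t)\<^sup>2 * cos (t * y)) =
        trig t (- 0 * t) (a * t) y + trig (3 * t) (- 0 * (3 * t)) (b * (3 * t)) y" for y
      using t unfolding trig_def a_def b_def mult.assoc[of 3 t] cos_treble_cos
      by (simp add: field_simps power3_eq_cube power2_eq_square sin_squared_eq[unfolded power2_eq_square])
    have "lam p * (\<integral>x. X x * (sin (t * X x) / t) ^ 3 \<partial>M) =
      lam p * (\<integral>x. X x * trig t a 0 (X x) \<partial>M) + lam p * (\<integral>x. X x * trig (3 * t) b 0 (X x) \<partial>M)"
      unfolding 1 using int[OF chaos_integrable(1)] by (simp add: distrib_left)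
    also have "\<dots> = (\<integral>x. 3 * ((sin (t * X x) / t)\<^sup>2 * cos (t * X x)) * G x \<partial>M)"
      unfolding 2 trig_integration_by_parts distrib_right
      by (rule Bochner_Integration.integral_add[symmetric]) (use int[OF chaos_integrable(5)] in \<open>auto simp: mult.commute\<close>)
    finally show ?thesis .
  qed
  define \<tau> where "\<tau> = (\<lambda>n. 1 / real (Suc n))"
  have tau0: "\<tau> n \<noteq> 0" for n by (simp add: \<tau>_def)
  have tau: "\<tau> \<longlonglongrightarrow> 0" unfolding \<tau>_def using LIMSEQ_inverse_real_of_nat by (simp add: inverse_eq_divide)
  have sinc: "(\<lambda>n. sin (\<tau> n * y) / \<tau> n) \<longlonglongrightarrow> y" for y
  proof -
    have "((\<lambda>t. sin (t * y)) has_field_derivative y) (at 0)"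
      by (auto intro!: derivative_eq_intros)
    then have "((\<lambda>t. sin (t * y) / t) \<longlongrightarrow> y) (at 0)" by (simp add: DERIV_def)
    then show ?thesis
      by (rule filterlim_compose) (use tau tau0 in \<open>auto simp: filterlim_at\<close>)
  qed
  have sinc_bound: "\<bar>sin (t * y) / t\<bar> \<le> \<bar>y\<bar>" if "t \<noteq> 0" for t y :: real
    using abs_sin_x_le_abs_x[of "t * y"] that by (simp add: abs_mult divide_le_eq mult.commute)
  have lim1: "(\<lambda>n. \<integral>x. X x * (sin (\<tau> n * X x) / \<tau> n) ^ 3 \<partial>M) \<longlonglongrightarrow> (\<integral>x. X x * X x ^ 3 \<partial>M)"
  proof (rule integral_dominated_convergence[where w = "\<lambda>x. \<bar>X x\<bar> * \<bar>X x\<bar> ^ 3"])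
    show "integrable M (\<lambda>x. \<bar>X x\<bar> * \<bar>X x\<bar> ^ 3)"
      using chaos_integrable(4) by (simp add: numeral_eq_Suc mult_ac flip: abs_mult)
    show "AE x in M. (\<lambda>n. X x * (sin (\<tau> n * X x) / \<tau> n) ^ 3) \<longlonglongrightarrow> X x * X x ^ 3"
      by (intro AE_I2 tendsto_intros sinc)
    show "AE x in M. norm (X x * (sin (\<tau> n * X x) / \<tau> n) ^ 3) \<le> \<bar>X x\<bar> * \<bar>X x\<bar> ^ 3" for n
      unfolding real_norm_def abs_mult power_abs
      by (intro AE_I2 mult_left_mono power_mono sinc_bound tau0) auto
  qed measurable
  have lim2: "(\<lambda>n. \<integral>x. 3 * ((sin (\<tau> n * X x) / \<tau> n)\<^sup>2 * cos (\<tau> n * X x)) * G x \<partial>M)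
      \<longlonglongrightarrow> (\<integral>x. 3 * ((X x)\<^sup>2 * cos (0 * X x)) * G x \<partial>M)"
  proof (rule integral_dominated_convergence[where w = "\<lambda>x. 3 * (\<bar>X x\<bar>\<^sup>2 * 1) * \<bar>G x\<bar>"])
    show "integrable M (\<lambda>x. 3 * (\<bar>X x\<bar>\<^sup>2 * 1) * \<bar>G x\<bar>)"
      using integrable_abs[OF chaos_integrable(7)] by (simp add: abs_mult mult.assoc)
    show "AE x in M. (\<lambda>n. 3 * ((sin (\<tau> n * X x) / \<tau> n)\<^sup>2 * cos (\<tau> n * X x)) * G x)
        \<longlonglongrightarrow> 3 * ((X x)\<^sup>2 * cos (0 * X x)) * G x"
      by (intro AE_I2 tendsto_intros sinc tau)
    show "AE x in M. norm (3 * ((sin (\<tau> n * X x) / \<tau> n)\<^sup>2 * cos (\<tau> n * X x)) * G x)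
        \<le> 3 * (\<bar>X x\<bar>\<^sup>2 * 1) * \<bar>G x\<bar>" for n
      unfolding real_norm_def abs_mult power_abs abs_numeral
      by (intro AE_I2 mult_right_mono mult_left_mono mult_mono power_mono sinc_bound tau0) auto
  qed measurable
  have "(\<lambda>n. lam p * (\<integral>x. X x * (sin (\<tau> n * X x) / \<tau> n) ^ 3 \<partial>M))
      \<longlonglongrightarrow> lam p * (\<integral>x. X x * X x ^ 3 \<partial>M)"
    by (rule tendsto_mult[OF tendsto_const lim1])
  then have "lam p * (\<integral>x. X x * X x ^ 3 \<partial>M) = (\<integral>x. 3 * ((X x)\<^sup>2 * cos (0 * X x)) * G x \<partial>M)"
    unfolding approx[OF tau0] using lim2 by (rule LIMSEQ_unique)
  also have "(\<lambda>x. X x * X x ^ 3) = (\<lambda>x. X x ^ 4)" by (simp add: numeral_eq_Suc)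
  finally show ?thesis by (simp add: mult.assoc)
qed

text \<open>
  The spectral inequality for \<open>U = X\<^sup>2 - 2X - \<nu>\<close>, for which \<open>(L + 2\<lambda>) U = 2 (G - \<lambda> (X + \<nu>))\<close>.
  The term \<open>-2X\<close> is chosen because \<open>(L + 2\<lambda>) X = \<lambda> X\<close>, and the constant because
  \<open>(L + 2\<lambda>) \<nu> = 2\<lambda>\<nu>\<close>.
\<close>
lemma carre_deviation_bound:
  assumes lam2: "lam (2 * p) \<le> 2 * lam p"
  shows "(\<integral>x. (G x - lam p * (X x + \<nu>))\<^sup>2 \<partial>M) \<le> (lam p)\<^sup>2 / 3 *
    (moment M 4 X - 6 * moment M 3 X + 6 * (1 - \<nu>) * moment M 2 X + 3 * \<nu>\<^sup>2)"
proof -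
  define W where "W = (\<lambda>x. G x - lam p * (X x + \<nu>))"
  define U where "U = (\<lambda>x. (X x)\<^sup>2 - 2 * X x - \<nu>)"
  have Udom: "U \<in> D" and LU: "AE x in M. L U x = L (\<lambda>x. (X x)\<^sup>2) x + 2 * lam p * X x"
  proof -
    let ?Z = "\<lambda>x. - 2 * X x + - \<nu> * 1"
    have Z: "?Z \<in> D" "AE x in M. L ?Z x = - 2 * L X x + - \<nu> * L (\<lambda>_. 1) x"
      using domain_lincomb[OF chaos_domain one_in_domain] by blast+
    have eq: "(\<lambda>x. 1 * (X x)\<^sup>2 + 1 * (- 2 * X x + - \<nu> * 1)) = U"
      by (auto simp: U_def)
    show "U \<in> D" using domain_lincomb(1)[OF chaos_square_domain Z(1), of 1 1] unfolding eq .
    have "AE x in M. L U x = 1 * L (\<lambda>x. (X x)\<^sup>2) x + 1 * L ?Z x"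
      using domain_lincomb(2)[OF chaos_square_domain Z(1), of 1 1] unfolding eq .
    then show "AE x in M. L U x = L (\<lambda>x. (X x)\<^sup>2) x + 2 * lam p * X x"
      using Z(2) chaos_L L_one by eventually_elim simp
  qed
  have Usum: "U \<in> direct_sum_upto M V (2 * p)"
  proof -
    have "X \<in> direct_sum_upto M V (2 * p)"
      by (rule eigenspace_subset_direct_sum[OF chaos_eigenspace]) simp
    moreover have "(\<lambda>_. - \<nu>) \<in> direct_sum_upto M V (2 * p)"
      by (rule eigenspace_subset_direct_sum[OF const_in_eigenspace_0]) simp
    ultimately have "(\<lambda>x. 1 * (X x)\<^sup>2 + 1 * (- 2 * X x + 1 * - \<nu>)) \<in> direct_sum_upto M V (2 * p)"
      by (intro direct_sum_lincomb chaos_square)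
    then show ?thesis by (simp add: U_def algebra_simps)
  qed
  have [measurable]: "U \<in> borel_measurable M" "L U \<in> borel_measurable M" "W \<in> borel_measurable M"
    using domain_subset_L2[OF Udom] L_in_L2[OF Udom] L2D(1) by (blast, blast, simp add: W_def)
  have twoW: "AE x in M. 2 * lam p * U x + L U x = 2 * W x"
    using LU carre_AE by eventually_elim (simp add: U_def W_def algebra_simps)
  note int = chaos_integrable
  have UW: "(\<integral>x. U x * W x \<partial>M) = lam p / 3 *
    (moment M 4 X - 6 * moment M 3 X + 6 * (1 - \<nu>) * moment M 2 X + 3 * \<nu>\<^sup>2)"
  proof -
    have "(\<lambda>x. U x * W x) = (\<lambda>x. X x ^ 2 * G x - 2 * (X x * G x) - \<nu> * G x
        - lam p * X x ^ 3 - lam p * (\<nu> - 2) * X x ^ 2 + 3 * lam p * \<nu> * X x + lam p * \<nu>\<^sup>2)"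
      by (auto simp: U_def W_def numeral_eq_Suc algebra_simps)
    then have "(\<integral>x. U x * W x \<partial>M) = (\<integral>x. X x ^ 2 * G x \<partial>M) - 2 * (\<integral>x. X x * G x \<partial>M) - \<nu> * (\<integral>x. G x \<partial>M)
        - lam p * (\<integral>x. X x ^ 3 \<partial>M) - lam p * (\<nu> - 2) * (\<integral>x. X x ^ 2 \<partial>M)
        + 3 * lam p * \<nu> * (\<integral>x. X x \<partial>M) + lam p * \<nu>\<^sup>2"
      using int by (simp add: prob_space)
    also have "\<dots> = lam p / 3 *
      (moment M 4 X - 6 * moment M 3 X + 6 * (1 - \<nu>) * moment M 2 X + 3 * \<nu>\<^sup>2)"
      unfolding carre_second_moment carre_first_moment carre_expectation chaos_centered moment_def
      by (simp add: field_simps)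
    finally show ?thesis .
  qed
  have "4 * (\<integral>x. (W x)\<^sup>2 \<partial>M) = (\<integral>x. (2 * W x)\<^sup>2 \<partial>M)"
    by (simp add: power_mult_distrib)
  also have "\<dots> = (\<integral>x. (2 * lam p * U x + L U x)\<^sup>2 \<partial>M)"
    by (rule integral_cong_AE) (use twoW in auto)
  also have "\<dots> \<le> 2 * lam p * (\<integral>x. U x * (2 * lam p * U x + L U x) \<partial>M)"
    by (rule spectral_inequality[OF Usum]) (use lam2 in simp)
  also have "(\<integral>x. U x * (2 * lam p * U x + L U x) \<partial>M) = (\<integral>x. 2 * (U x * W x) \<partial>M)"
    by (rule integral_cong_AE) (use twoW in auto)
  also have "\<dots> = 2 * (\<integral>x. U x * W x \<partial>M)" by simp
  finally have "(\<integral>x. (W x)\<^sup>2 \<partial>M) \<le> lam p * (\<integral>x. U x * W x \<partial>M)" by simp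
  then show ?thesis unfolding UW by (simp add: W_def power2_eq_square mult.assoc)
qed

text \<open>
  Integration by parts turns \<open>\<lambda> E[X exp(isY)]\<close>, with \<open>Y = X + \<nu>\<close>, into \<open>is E[G exp(isY)]\<close>, so \<open>\<lambda>\<close>
  times the Stein discrepancy is \<open>is E[(G - \<lambda> Y) exp(isY)]\<close>. Its modulus is at most \<open>\<bar>s\<bar>\<close> times
  the \<open>L\<^sup>2\<close> norm of \<open>G - \<lambda> Y\<close>.
\<close>
lemma Stein_discrepancy_bound:
  assumes lam2: "lam (2 * p) \<le> 2 * lam p"
    and Q: "Q = moment M 4 X - 6 * moment M 3 X + 6 * (1 - \<nu>) * moment M 2 X + 3 * \<nu>\<^sup>2"
  shows "norm ((CLINT x|M. ((X x + \<nu>) - \<nu>) * iexp (s * (X x + \<nu>))) -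
                  \<i> * s * (CLINT x|M. (X x + \<nu>) * iexp (s * (X x + \<nu>)))) \<le> sqrt (Q / 3) * \<bar>s\<bar>"
proof -
  define W where "W = (\<lambda>x. G x - lam p * (X x + \<nu>))"
  have WL2: "W \<in> L2 M"
  proof -
    have "(\<lambda>x. 1 * G x + - lam p * (1 * X x + \<nu> * 1)) \<in> L2 M"
      by (intro L2_lincomb chaos_L2 carre_L2 one_L2)
    then show ?thesis by (simp add: W_def)
  qed
  then have Wm[measurable]: "W \<in> borel_measurable M" and W2: "integrable M (\<lambda>x. (W x)\<^sup>2)"
    by (auto dest: L2D)
  have W1: "integrable M W" by (rule square_integrable_imp_integrable[OF Wm W2])
  have cint: "integrable M (\<lambda>x. complex_of_real (Z x) * iexp (s * (X x + c)))" if Z: "integrable M Z" for Z c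
  proof -
    have [measurable]: "Z \<in> borel_measurable M" using Z by auto
    show ?thesis by (rule Bochner_Integration.integrable_bound[OF Z]) (auto simp: norm_mult)
  qed
  have rint: "integrable M (\<lambda>x. Z x * sin (s * X x))" "integrable M (\<lambda>x. Z x * cos (s * X x))"
    if Z: "integrable M Z" for Z
  proof -
    have [measurable]: "Z \<in> borel_measurable M" using Z by auto
    show "integrable M (\<lambda>x. Z x * sin (s * X x))" "integrable M (\<lambda>x. Z x * cos (s * X x))"
      by (rule Bochner_Integration.integrable_bound[OF Z]; auto simp: abs_mult mult_left_le)+
  qed
  have split: "(CLINT x|M. Z x * iexp (s * X x)) =
      complex_of_real (\<integral>x. Z x * cos (s * X x) \<partial>M) + \<i> * complex_of_real (\<integral>x. Z x * sin (s * X x) \<partial>M)"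
    if Z: "integrable M Z" for Z
  proof -
    have "(CLINT x|M. Z x * iexp (s * X x)) =
        (CLINT x|M. complex_of_real (Z x * cos (s * X x)) + \<i> * complex_of_real (Z x * sin (s * X x)))"
      by (intro Bochner_Integration.integral_cong refl)
        (simp add: exp_Euler cos_of_real sin_of_real algebra_simps flip: of_real_mult)
    also have "\<dots> = (CLINT x|M. complex_of_real (Z x * cos (s * X x))) +
        (CLINT x|M. \<i> * complex_of_real (Z x * sin (s * X x)))"
      by (rule Bochner_Integration.integral_add; intro integrable_mult_right integrable_of_real rint Z)
    finally show ?thesis by (simp only: integral_mult_right_zero integral_complex_of_real)
  qed
  have ibp: "lam p * (CLINT x|M. X x * iexp (s * X x)) = \<i> * s * (CLINT x|M. G x * iexp (s * X x))"
  proof -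
    have 1: "lam p * (\<integral>x. X x * sin (s * X x) \<partial>M) = s * (\<integral>x. G x * cos (s * X x) \<partial>M)"
      using trig_integration_by_parts[of s 1 0] by (simp add: trig_def mult_ac)
    have 2: "lam p * (\<integral>x. X x * cos (s * X x) \<partial>M) = - s * (\<integral>x. G x * sin (s * X x) \<partial>M)"
      using trig_integration_by_parts[of s 0 1] by (simp add: trig_def mult_ac)
    show ?thesis
      unfolding split[OF chaos_integrable(1)] split[OF chaos_integrable(5)]
      using 1 2 by (simp add: complex_eq_iff)
  qed
  have shift: "(CLINT x|M. Z x * iexp (s * (X x + \<nu>))) = iexp (s * \<nu>) * (CLINT x|M. Z x * iexp (s * X x))"
    for Z :: "'a \<Rightarrow> real"
  proof -
    have "(\<lambda>x. Z x * iexp (s * (X x + \<nu>))) = (\<lambda>x. iexp (s * \<nu>) * (Z x * iexp (s * X x)))"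
      by (simp add: distrib_left exp_add mult_ac fun_eq_iff)
    then show ?thesis by simp
  qed
  have X1: "integrable M (\<lambda>x. X x + \<nu>)" using chaos_integrable(1) by simp
  have "lam p * (CLINT x|M. X x * iexp (s * (X x + \<nu>))) = \<i> * s * (CLINT x|M. G x * iexp (s * (X x + \<nu>)))"
    unfolding shift using ibp by (simp add: mult_ac)
  moreover have "(CLINT x|M. W x * iexp (s * (X x + \<nu>))) = (CLINT x|M. G x * iexp (s * (X x + \<nu>)))
     - lam p * (CLINT x|M. complex_of_real (X x + \<nu>) * iexp (s * (X x + \<nu>)))"
  proof -
    have "(CLINT x|M. W x * iexp (s * (X x + \<nu>))) =
      (CLINT x|M. G x * iexp (s * (X x + \<nu>)) - lam p * (complex_of_real (X x + \<nu>) * iexp (s * (X x + \<nu>))))"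
      by (simp add: W_def algebra_simps)
    also have "\<dots> = (CLINT x|M. G x * iexp (s * (X x + \<nu>)))
      - (CLINT x|M. lam p * (complex_of_real (X x + \<nu>) * iexp (s * (X x + \<nu>))))"
      by (rule Bochner_Integration.integral_diff; intro integrable_mult_right cint chaos_integrable X1)
    finally show ?thesis by simp
  qed
  ultimately have "lam p * ((CLINT x|M. X x * iexp (s * (X x + \<nu>))) -
      \<i> * s * (CLINT x|M. complex_of_real (X x + \<nu>) * iexp (s * (X x + \<nu>)))) =
      \<i> * s * (CLINT x|M. W x * iexp (s * (X x + \<nu>)))"
    by (simp add: right_diff_distrib mult_ac)
  then have "norm (lam p * ((CLINT x|M. X x * iexp (s * (X x + \<nu>))) -
      \<i> * s * (CLINT x|M. complex_of_real (X x + \<nu>) * iexp (s * (X x + \<nu>))))) =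
      norm (\<i> * s * (CLINT x|M. W x * iexp (s * (X x + \<nu>))))" by simp
  then have "lam p * norm ((CLINT x|M. X x * iexp (s * (X x + \<nu>))) -
      \<i> * s * (CLINT x|M. complex_of_real (X x + \<nu>) * iexp (s * (X x + \<nu>)))) =
      \<bar>s\<bar> * norm (CLINT x|M. W x * iexp (s * (X x + \<nu>)))"
    using lam_p_pos by (simp only: norm_mult norm_of_real norm_ii mult_1_left abs_of_pos)
  also have "\<dots> \<le> \<bar>s\<bar> * (lam p * sqrt (Q / 3))"
  proof (rule mult_left_mono)
    have "norm (CLINT x|M. W x * iexp (s * (X x + \<nu>))) \<le> (\<integral>x. norm (W x * iexp (s * (X x + \<nu>))) \<partial>M)"
      by (rule integral_norm_bound)
    also have "\<dots> = (\<integral>x. \<bar>W x\<bar> \<partial>M)" by (simp add: norm_mult)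
    also have "\<dots> \<le> sqrt (\<integral>x. (W x)\<^sup>2 \<partial>M)"
    proof (rule real_le_rsqrt)
      \<comment> \<open>Jensen's inequality for the square, in the form of a nonnegative variance.\<close>
      have "0 \<le> variance (\<lambda>x. \<bar>W x\<bar>)" by (rule variance_positive)
      also have "\<dots> = (\<integral>x. \<bar>W x\<bar>\<^sup>2 \<partial>M) - (\<integral>x. \<bar>W x\<bar> \<partial>M)\<^sup>2"
        using W1 W2 by (intro variance_eq) auto
      finally show "(\<integral>x. \<bar>W x\<bar> \<partial>M)\<^sup>2 \<le> (\<integral>x. (W x)\<^sup>2 \<partial>M)" by simp
    qed
    also have "\<dots> \<le> sqrt ((lam p)\<^sup>2 / 3 * Q)"
      using carre_deviation_bound[OF lam2, of \<nu>] by (simp add: W_def Q)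
    also have "\<dots> = lam p * sqrt (Q / 3)"
      using lam_p_pos by (simp add: real_sqrt_mult flip: times_divide_eq_right)
    finally show "norm (CLINT x|M. W x * iexp (s * (X x + \<nu>))) \<le> lam p * sqrt (Q / 3)" .
  qed simp
  also have "\<dots> = lam p * (sqrt (Q / 3) * \<bar>s\<bar>)" by simp
  finally show ?thesis using lam_p_pos by simp
qed

end

end

section \<open>The two implications\<close>

context diffusive_markov_generator
begin

lemma moment_condition_imp_gamma_convergence:
  fixes X :: "nat \<Rightarrow> 'a \<Rightarrow> real"
  assumes p: "p \<ge> 1" and lam2: "lam (2 * p) \<le> 2 * lam p" and nu: "\<nu> > 0"
    and chaos: "\<And>n. chaos_eigenfunction M D L lam p (X n)"
    and conv: "(\<lambda>n. moment M 4 (X n) - 6 * moment M 3 (X n) + 6 * (1 - \<nu>) * moment M 2 (X n) + 3 * \<nu>\<^sup>2)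
      \<longlonglongrightarrow> 0"
  shows "weak_conv_m (\<lambda>n. distr M borel (\<lambda>x. X n x + \<nu>)) (gamma_distribution \<nu>)"
proof (rule levy_continuity)
  define Q where "Q = (\<lambda>n. moment M 4 (X n) - 6 * moment M 3 (X n) + 6 * (1 - \<nu>) * moment M 2 (X n) + 3 * \<nu>\<^sup>2)"
  have Xm[measurable]: "X n \<in> borel_measurable M" for n
    by (rule chaos_measurable(1)[OF p chaos])
  show "real_distribution (distr M borel (\<lambda>x. X n x + \<nu>))" for n
    by (intro real_distribution_distr) simp
  show "real_distribution (gamma_distribution \<nu>)" using nu by (rule real_distribution_gamma)
  fix t
  define h where "h = (1 - \<i> * complex_of_real t) powr complex_of_real \<nu>"
  have h: "h \<noteq> 0" using one_minus_i_times_nonzero by (simp add: h_def powr_def)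
  have close: "norm (char (distr M borel (\<lambda>x. X n x + \<nu>)) t * h - 1)
      \<le> sqrt (Q n / 3) * t\<^sup>2 * (1 + \<bar>t\<bar>) powr \<nu>" for n
  proof -
    have "integrable M (\<lambda>x. (X n x)\<^sup>2 + 2 * \<nu> * X n x + \<nu>\<^sup>2)"
      using chaos_integrable(1,2)[OF p chaos] by simp
    then have "integrable M (\<lambda>x. (X n x + \<nu>)\<^sup>2)" by (simp add: power2_sum mult_ac add_ac)
    then have "norm ((CLINT x|M. iexp (t * (X n x + \<nu>))) * h - 1)
        \<le> sqrt (Q n / 3) * t\<^sup>2 * (1 + \<bar>t\<bar>) powr \<nu>"
      unfolding h_def
      by (intro approximate_Stein_identity_imp_char_close nu
            Stein_discrepancy_bound[OF p chaos lam2]) (simp_all add: Q_def)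
    then show ?thesis by (simp add: char_def integral_distr)
  qed
  have "(\<lambda>n. char (distr M borel (\<lambda>x. X n x + \<nu>)) t * h - 1) \<longlonglongrightarrow> 0"
  proof (rule Lim_null_comparison)
    show "\<forall>\<^sub>F n in sequentially. norm (char (distr M borel (\<lambda>x. X n x + \<nu>)) t * h - 1)
      \<le> sqrt (Q n / 3) * t\<^sup>2 * (1 + \<bar>t\<bar>) powr \<nu>"
      using close by simp
    have "(\<lambda>n. sqrt (Q n / 3) * t\<^sup>2 * (1 + \<bar>t\<bar>) powr \<nu>) \<longlonglongrightarrow> sqrt (0 / 3) * t\<^sup>2 * (1 + \<bar>t\<bar>) powr \<nu>"
      using conv unfolding Q_def by (intro tendsto_intros) auto
    then show "(\<lambda>n. sqrt (Q n / 3) * t\<^sup>2 * (1 + \<bar>t\<bar>) powr \<nu>) \<longlonglongrightarrow> 0" by simp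
  qed
  then have "(\<lambda>n. ((char (distr M borel (\<lambda>x. X n x + \<nu>)) t * h - 1) + 1) / h) \<longlonglongrightarrow> (0 + 1) / h"
    by (intro tendsto_intros h)
  moreover have "(0 + 1) / h = char (gamma_distribution \<nu>) t"
    using char_gamma_distribution[OF nu, of t] h by (simp add: h_def field_simps)
  ultimately show "(\<lambda>n. char (distr M borel (\<lambda>x. X n x + \<nu>)) t) \<longlonglongrightarrow> char (gamma_distribution \<nu>) t"
    using h by simp
qed

lemma gamma_convergence_imp_moment_condition:
  fixes X :: "nat \<Rightarrow> 'a \<Rightarrow> real"
  assumes nu: "\<nu> > 0"
    and eig: "\<And>n. X n \<in> V p"
    and bdd: "bounded_in_Lr M 2 X"
    and conv: "weak_conv_m (\<lambda>n. distr M borel (\<lambda>x. X n x + \<nu>)) (gamma_distribution \<nu>)"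
  shows "(\<lambda>n. moment M 4 (X n) - 6 * moment M 3 (X n) + 6 * (1 - \<nu>) * moment M 2 (X n) + 3 * \<nu>\<^sup>2)
      \<longlonglongrightarrow> 0"
proof -
  have Xm[measurable]: "X n \<in> borel_measurable M" for n
    using bdd by (simp add: bounded_in_Lr_def)
  have moment_conv: "(\<lambda>n. moment M k (X n)) \<longlonglongrightarrow> (\<integral>x. (x - \<nu>) ^ k \<partial>gamma_distribution \<nu>)"
    if k: "k \<ge> 1" for k
  proof -
    have "bounded_in_Lr M (real (2 * k)) X"
      by (rule hypercontractive[OF _ eig bdd]) (use k in simp)
    moreover have "\<bar>y\<bar> powr real (2 * k) = (y ^ k)\<^sup>2" for y :: real
    proof (cases "y = 0")
      case False
      then have "\<bar>y\<bar> powr real (2 * k) = \<bar>y\<bar> ^ (2 * k)" by (intro powr_realpow) simp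
      then show ?thesis by (simp add: power_mult flip: power_even_eq)
    qed (use k in simp)
    ultimately obtain C where int: "\<And>n. integrable M (\<lambda>x. (X n x ^ k)\<^sup>2)"
      and C: "\<And>n. (\<integral>x. (X n x ^ k)\<^sup>2 \<partial>M) \<le> C"
      unfolding bounded_in_Lr_def by auto
    have "(\<lambda>n. \<integral>x. (x - \<nu>) ^ k \<partial>distr M borel (\<lambda>x. X n x + \<nu>)) \<longlonglongrightarrow>
        (\<integral>x. (x - \<nu>) ^ k \<partial>gamma_distribution \<nu>)"
    proof (rule weak_conv_imp_expectation_conv[OF _ _ conv])
      show "real_distribution (distr M borel (\<lambda>x. X n x + \<nu>))" for n
        by (intro real_distribution_distr) simp
      show "real_distribution (gamma_distribution \<nu>)" using nu by (rule real_distribution_gamma)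
      show "continuous_on UNIV (\<lambda>x. (x - \<nu>) ^ k)" by (intro continuous_intros)
      show "integrable (distr M borel (\<lambda>x. X n x + \<nu>)) (\<lambda>x. ((x - \<nu>) ^ k)\<^sup>2)" for n
        using int by (subst integrable_distr_eq) auto
      show "(\<integral>x. ((x - \<nu>) ^ k)\<^sup>2 \<partial>distr M borel (\<lambda>x. X n x + \<nu>)) \<le> C" for n
        using C by (subst integral_distr) auto
      have "((x - \<nu>) ^ k)\<^sup>2 = poly ([:- \<nu>, 1:] ^ k * [:- \<nu>, 1:] ^ k) x" for x
        by (simp add: power2_eq_square)
      then have "(\<lambda>x. ((x - \<nu>) ^ k)\<^sup>2) = poly ([:- \<nu>, 1:] ^ k * [:- \<nu>, 1:] ^ k)"
        by blast
      then show "integrable (gamma_distribution \<nu>) (\<lambda>x. ((x - \<nu>) ^ k)\<^sup>2)"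
        using integrable_gamma_poly[OF nu] by (simp only:)
    qed
    then show ?thesis by (simp add: integral_distr moment_def)
  qed
  have "(\<lambda>n. moment M 4 (X n) - 6 * moment M 3 (X n) + 6 * (1 - \<nu>) * moment M 2 (X n) + 3 * \<nu>\<^sup>2)
    \<longlonglongrightarrow> (\<integral>x. (x - \<nu>)^4 \<partial>gamma_distribution \<nu>) - 6 * (\<integral>x. (x - \<nu>)^3 \<partial>gamma_distribution \<nu>)
    + 6 * (1 - \<nu>) * (\<integral>x. (x - \<nu>)^2 \<partial>gamma_distribution \<nu>) + 3 * \<nu>\<^sup>2"
    by (intro tendsto_intros moment_conv) auto
  then show ?thesis unfolding gamma_centered_moment_combination[OF nu] .
qed

end

theorem corollary3p5:
  fixes M :: "'a measure"
    and D :: "('a \<Rightarrow> real) set"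
    and L :: "('a \<Rightarrow> real) \<Rightarrow> 'a \<Rightarrow> real"
    and lam :: "nat \<Rightarrow> real"
    and \<nu> :: real
    and p :: nat
    and X Y :: "nat \<Rightarrow> 'a \<Rightarrow> real"
  assumes "diffusive_markov_generator M D L lam"
    and "\<nu> > 0"
    and "p \<ge> 1"
    and "lam (2 * p) \<le> 2 * lam p"
    and "\<And>n. chaos_eigenfunction M D L lam p (X n)"
    and "bounded_in_Lr M 2 X"
    and "\<And>n x. Y n x = X n x + \<nu>"
  shows "weak_conv_m (\<lambda>n. distr M borel (Y n)) (gamma_distribution \<nu>) \<longleftrightarrow>
    (\<lambda>n. moment M 4 (X n) - 6 * moment M 3 (X n) + 6 * (1 - \<nu>) * moment M 2 (X n) + 3 * \<nu>\<^sup>2)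
      \<longlonglongrightarrow> 0"
proof -
  interpret diffusive_markov_generator M D L lam by (rule assms)
  have Y: "Y n = (\<lambda>x. X n x + \<nu>)" for n using assms(7) by auto
  have eig: "X n \<in> V p" for n using assms(5)[of n] by (simp add: chaos_eigenfunction_def)
  show ?thesis
    unfolding Y
  proof
    assume "weak_conv_m (\<lambda>n. distr M borel (\<lambda>x. X n x + \<nu>)) (gamma_distribution \<nu>)"
    with assms(2) eig assms(6) show "(\<lambda>n. moment M 4 (X n) - 6 * moment M 3 (X n)
        + 6 * (1 - \<nu>) * moment M 2 (X n) + 3 * \<nu>\<^sup>2) \<longlonglongrightarrow> 0"
      by (rule gamma_convergence_imp_moment_condition)
  next
    assume "(\<lambda>n. moment M 4 (X n) - 6 * moment M 3 (X n)
        + 6 * (1 - \<nu>) * moment M 2 (X n) + 3 * \<nu>\<^sup>2) \<longlonglongrightarrow> 0"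
    with assms(3,4,2,5) show "weak_conv_m (\<lambda>n. distr M borel (\<lambda>x. X n x + \<nu>)) (gamma_distribution \<nu>)"
      by (rule moment_condition_imp_gamma_convergence)
  qed
qed

end
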